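(* Let $(X,d,\mu)$ be a locally compact, separable, doubling metric measure space with $\operatorname{supp}\mu=X$, let $\mathcal V\to X$ be a Euclidean vector bundle of finite rank, and let $A$ be a nonnegative self-adjoint operator on $L^2(X;\mathcal V)$ satisfying ultracontractivity (A1), the Davies--Gaffney estimates (A2) and the local Weyl law (A3) (all spelled out in the context). Let $\omega\subset X$ be measurable with $\mu(\omega)>0$. Assume that there exist $T_0>0$, $C>0$ and $K>0$ such that, for every $T\in(0,T_0]$, $$\forall f\in L^2(X;\mathcal V),\qquad \|e^{-TA}f\|_{L^2(X;\mathcal V)}^2\le C\,e^{K/T}\int_0^T\|e^{-tA}f\|_{L^2(\omega;\mathcal V)}^2\,dt.$$ Then $K\ge\frac12\mathcal L(\omega)^2$, where $\mathcal L(\omega)\in[0,+\infty]$ is the essential maximal distance to $\omega$. Equivalently, the $L^2$ null-control rate $\mathcal K_{\rm heat}$ satisfies $\mathcal K_{\rm heat}\ge\mathcal L(\omega)^2/4$.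
   Context: **Space and bundle.** $(X,d,\mu)$ is a locally compact separable metric space with a Radon measure $\mu$, $\operatorname{supp}\mu=X$, $0<\mu(B(x,r))<+\infty$ for all $x\in X$, $r>0$, and there is $C_D>0$ with $\mu(B(x,2r))\le C_D\,\mu(B(x,r))$ for all $x\in X$, $r>0$ (doubling). $\mathcal V\to X$ is a vector bundle of finite rank $r_{\mathcal V}$ with fiberwise inner products $\langle\cdot,\cdot\rangle_{\mathcal V_x}$; $L^p(X;\mathcal V)$ are the $L^p$ sections; $\|\cdot\|_{p\to q}$ is the operator norm $L^p(X;\mathcal V)\to L^q(X;\mathcal V)$; $\mathcal L(\mathcal V_y,\mathcal V_x)$ denotes linear maps. **$\Delta$-a.e.** A property of pairs $(x,y)$ holds $\Delta$-a.e. if there is a $\mu$-null set $N\subset X$ such that it holds for all $(x,y)\in(X\setminus N)^2$. A kernel $K(x,y)\in\mathcal L(\mathcal V_y,\mathcal V_x)$ defined up to $\Delta$-a.e. equality has a diagonal $K(x,x)$ well defined for $\mu$-a.e. $x$. **Assumptions on the nonnegative self-adjoint operator $A$ on $L^2(X;\mathcal V)$.** (A1) For every $t>0$, $e^{-tA}$ is bounded $L^2(X;\mathcal V)\to L^\infty(X;\mathcal V)$, and there are $\alpha_1>0$, $C>0$ with $\|e^{-tA}\|_{2\to\infty}\le C\,t^{-\alpha_1/2}$ for all $t\in(0,1]$. (A2) For all measurable $E,F\subset X$ and $t>0$, $\|1_Fe^{-tA}1_E\|_{L^2\to L^2}\le e^{-d(E,F)^2/(4t)}$. (A3) There are $\alpha_2>0$,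 a slowly varying function $\chi_2:[0,+\infty)\to(0,+\infty)$ (i.e. $\chi_2(a\lambda)/\chi_2(\lambda)\to1$ as $\lambda\to+\infty$ for every $a>0$) and a measurable $c:X\to(0,+\infty)$ such that for $\mu$-a.e. $x$, $E_x(\lambda)\sim c(x)\lambda^{\alpha_2}\chi_2(\lambda)$ as $\lambda\to+\infty$, where $E_x(\lambda)=\mathrm{Tr}_{\mathcal V_x}\big(K_{1_{[0,\lambda]}(A)}(x,x)\big)$ and $K_{1_{[0,\lambda]}(A)}$ is the integral kernel of $1_{[0,\lambda]}(A)$, made precise as follows. Under (A1), there is a unique (up to $\Delta$-a.e. equality) family $(p_t)_{t>0}$ of $\Delta$-essentially bounded kernels with $(e^{-tA}f)(x)=\int_Xp_t(x,y)f(y)\,d\mu(y)$ for a.e. $x$ and all $f\in L^2$, $p_t(x,y)=p_t(y,x)^*$ and $p_{t+s}(x,y)=\int_Xp_t(x,z)p_s(z,y)\,d\mu(z)$ $\Delta$-a.e. Put $P_{t,x}:\mathcal V_x\to L^2(X;\mathcal V)$, $(P_{t,x}u)(y)=p_t(y,x)u$. For bounded Borel compactly supported $\phi$, the kernel of $\phi(A)$ is, $\Delta$-a.e., $K_{\phi(A)}(x,y)=P_{t/2,x}^*\,\phi(A)e^{tA}\,P_{t/2,y}$ (independent of $t>0$). **Essential distance.** $d_{\mathrm{ess}}(x,\omega)=\sup\{r>0:\mu(B(x,r)\cap\omega)=0\}$ with $\sup\emptyset=0$, and $\mathcal L(\omega)=\sup_{x\in X}d_{\mathrm{ess}}(x,\omega)\in[0,+\infty]$.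 **Null-control rate.** For $T>0$, $\mathcal C_T$ is the usual $L^2$ null-control cost in time $T$ of $\partial_ty+Ay=1_\omega u$, i.e. the smallest constant such that every initial datum $y_0\in L^2(X;\mathcal V)$ can be steered to $y(T)=0$ by a control $u$ with $\|u\|_{L^2((0,T)\times X)}\le\mathcal C_T\|y_0\|_{L^2}$. By duality, $\mathcal C_T^2$ equals the optimal constant $C_T$ in $\|e^{-TA}f\|_{L^2(X;\mathcal V)}^2\le C_T\int_0^T\|e^{-tA}f\|^2_{L^2(\omega;\mathcal V)}dt$ for all $f$. Then $\mathcal K_{\rm heat}=\inf\{K>0:\ \mathcal C_T\lesssim e^{K/T}\text{ as }T\to0^+\}$. *)

theory Defs
  imports
    "HOL-Analysis.Analysis"
    "HOL-Library.Landau_Symbols"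
    "HOL-Probability.Essential_Supremum"
begin

section \<open>Doubling metric measure spaces\<close>

definition measure_support :: "'x::topological_space measure \<Rightarrow> 'x set" where
  "measure_support M = {x. \<forall>U. open U \<and> x \<in> U \<longrightarrow> 0 < emeasure M U}"

definition radon_measure :: "'x::topological_space measure \<Rightarrow> bool" where
  "radon_measure M \<longleftrightarrow>
     sets M = sets borel \<and>
     (\<forall>K. compact K \<longrightarrow> emeasure M K < \<infinity>) \<and>
     (\<forall>S \<in> sets borel. emeasure M S = (INF U \<in> {U. open U \<and> S \<subseteq> U}. emeasure M U)) \<and>
     (\<forall>U. open U \<longrightarrow> emeasure M U = (SUP K \<in> {K. compact K \<and> K \<subseteq> U}. emeasure M K))"

definition doubling_metric_measure :: "'x::metric_space measure \<Rightarrow> bool" where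
  "doubling_metric_measure M \<longleftrightarrow>
     radon_measure M \<and> measure_support M = UNIV \<and>
     (\<forall>x r. 0 < r \<longrightarrow> 0 < emeasure M (ball x r) \<and> emeasure M (ball x r) < \<infinity>) \<and>
     (\<exists>C>0. \<forall>x r. 0 < r \<longrightarrow> emeasure M (ball x (2 * r)) \<le> ennreal C * emeasure M (ball x r))"

text \<open>In \<^typ>\<open>ennreal\<close> the supremum of the empty set is 0, which is the convention needed here.\<close>

definition ess_dist :: "'x::metric_space measure \<Rightarrow> 'x \<Rightarrow> 'x set \<Rightarrow> ennreal" where
  "ess_dist M x \<omega> = (SUP r \<in> {r. 0 < r \<and> emeasure M (ball x r \<inter> \<omega>) = 0}. ennreal r)"

definition max_ess_dist :: "'x::metric_space measure \<Rightarrow> 'x set \<Rightarrow> ennreal" where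
  "max_ess_dist M \<omega> = (SUP x. ess_dist M x \<omega>)"

text \<open>A property of pairs that holds off \<open>N \<times> UNIV \<union> UNIV \<times> N\<close> for a null set \<open>N\<close>.
  This is stronger than almost everywhere for the product measure; in particular it
  controls almost every point of the diagonal.\<close>

definition delta_AE :: "'x measure \<Rightarrow> ('x \<Rightarrow> 'x \<Rightarrow> bool) \<Rightarrow> bool" where
  "delta_AE M P \<longleftrightarrow> (\<exists>N \<in> null_sets M. \<forall>x y. x \<notin> N \<and> y \<notin> N \<longrightarrow> P x y)"


section \<open>Euclidean vector bundles\<close>

text \<open>The type \<open>'e\<close> is the total space. The operations are meaningful only on arguments lying in
  a common fibre.\<close>

record ('x, 'e) fibre_bundle =
  proj :: "'e \<Rightarrow> 'x"
  fplus :: "'e \<Rightarrow> 'e \<Rightarrow> 'e"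
  fscale :: "real \<Rightarrow> 'e \<Rightarrow> 'e"
  finner :: "'e \<Rightarrow> 'e \<Rightarrow> real"

definition fibre :: "('x, 'e) fibre_bundle \<Rightarrow> 'x \<Rightarrow> 'e set" where
  "fibre B x = {v. proj B v = x}"

definition fnorm :: "('x, 'e) fibre_bundle \<Rightarrow> 'e \<Rightarrow> real" where
  "fnorm B v = sqrt (finner B v v)"

text \<open>The type \<open>'f\<close> is the model fibre, of dimension the rank. The vector space axioms
  on the fibres follow from the existence of fibrewise linear trivialisations. The zero
  vector of the fibre of \<open>v\<close> is \<open>fscale B 0 v\<close>.\<close>

definition vector_bundle ::
  "'f::euclidean_space itself \<Rightarrow> ('x::topological_space, 'e::topological_space) fibre_bundle \<Rightarrow> bool" where
  "vector_bundle (_ :: 'f itself) B \<longleftrightarrow>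
     (\<forall>u v. proj B u = proj B v \<longrightarrow> proj B (fplus B u v) = proj B v) \<and>
     (\<forall>a v. proj B (fscale B a v) = proj B v) \<and>
     (\<forall>x. \<exists>U \<tau> \<sigma>. open U \<and> x \<in> U \<and>
        homeomorphism (proj B -` U) (U \<times> (UNIV :: 'f set)) \<tau> \<sigma> \<and>
        (\<forall>v \<in> proj B -` U. fst (\<tau> v) = proj B v) \<and>
        (\<forall>u \<in> proj B -` U. \<forall>v \<in> proj B -` U. proj B u = proj B v \<longrightarrow>
           snd (\<tau> (fplus B u v)) = snd (\<tau> u) + snd (\<tau> v)) \<and>
        (\<forall>a. \<forall>v \<in> proj B -` U. snd (\<tau> (fscale B a v)) = a *\<^sub>R snd (\<tau> v)))"

text \<open>The inner product is only required to be a Borel function on the fibre product;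
  continuous metrics are a special case.\<close>

definition fibre_inner_product ::
  "('x, 'e::topological_space) fibre_bundle \<Rightarrow> bool" where
  "fibre_inner_product B \<longleftrightarrow>
     (\<forall>u v. proj B u = proj B v \<longrightarrow> finner B u v = finner B v u) \<and>
     (\<forall>u v w. proj B u = proj B w \<and> proj B v = proj B w \<longrightarrow>
        finner B (fplus B u v) w = finner B u w + finner B v w) \<and>
     (\<forall>a u v. proj B u = proj B v \<longrightarrow> finner B (fscale B a u) v = a * finner B u v) \<and>
     (\<forall>v. v \<noteq> fscale B 0 v \<longrightarrow> 0 < finner B v v) \<and>
     (\<lambda>(u, v). finner B u v)
       \<in> borel_measurable (restrict_space borel {(u, v). proj B u = proj B v})"

definition euclidean_vector_bundle ::
  "'f::euclidean_space itself \<Rightarrow> ('x::topological_space, 'e::topological_space) fibre_bundle \<Rightarrow> bool" where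
  "euclidean_vector_bundle F B \<longleftrightarrow> vector_bundle F B \<and> fibre_inner_product B"

definition fibre_linear :: "('x, 'e) fibre_bundle \<Rightarrow> 'x \<Rightarrow> 'x \<Rightarrow> ('e \<Rightarrow> 'e) \<Rightarrow> bool" where
  "fibre_linear B y x L \<longleftrightarrow>
     (\<forall>u \<in> fibre B y. L u \<in> fibre B x) \<and>
     (\<forall>u \<in> fibre B y. \<forall>v \<in> fibre B y. L (fplus B u v) = fplus B (L u) (L v)) \<and>
     (\<forall>a. \<forall>u \<in> fibre B y. L (fscale B a u) = fscale B a (L u))"

definition fibre_orthonormal_basis :: "('x, 'e) fibre_bundle \<Rightarrow> 'x \<Rightarrow> 'e set \<Rightarrow> bool" where
  "fibre_orthonormal_basis B x b \<longleftrightarrow>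
     finite b \<and> b \<subseteq> fibre B x \<and>
     (\<forall>u \<in> b. \<forall>v \<in> b. finner B u v = (if u = v then 1 else 0)) \<and>
     (\<forall>w \<in> fibre B x. (\<forall>u \<in> b. finner B w u = 0) \<longrightarrow> w = fscale B 0 w)"

text \<open>For a linear endomorphism of the fibre the value does not depend on the basis.\<close>

definition fibre_trace :: "('x, 'e) fibre_bundle \<Rightarrow> 'x \<Rightarrow> ('e \<Rightarrow> 'e) \<Rightarrow> real" where
  "fibre_trace B x L = (\<Sum>u \<in> (SOME b. fibre_orthonormal_basis B x b). finner B (L u) u)"


section \<open>Sections and operators on square integrable sections\<close>

type_synonym ('x, 'e) bsection = "'x \<Rightarrow> 'e"
type_synonym ('x, 'e) operator = "('x \<Rightarrow> 'e) \<Rightarrow> ('x \<Rightarrow> 'e)"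

definition borel_sections ::
  "('x, 'e::topological_space) fibre_bundle \<Rightarrow> 'x measure \<Rightarrow> ('x, 'e) bsection set" where
  "borel_sections B M = {f \<in> borel_measurable M. \<forall>x. proj B (f x) = x}"

text \<open>Elements of \<open>L2\<close> are functions, not classes; operators are required to respect
  equality almost everywhere.\<close>

definition L2 ::
  "('x, 'e::topological_space) fibre_bundle \<Rightarrow> 'x measure \<Rightarrow> ('x, 'e) bsection set" where
  "L2 B M = {f \<in> borel_sections B M. integrable M (\<lambda>x. finner B (f x) (f x))}"

definition L2_inner ::
  "('x, 'e) fibre_bundle \<Rightarrow> 'x measure \<Rightarrow> ('x, 'e) bsection \<Rightarrow> ('x, 'e) bsection \<Rightarrow> real" where
  "L2_inner B M f g = (\<integral>x. finner B (f x) (g x) \<partial>M)"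

definition L2_norm ::
  "('x, 'e) fibre_bundle \<Rightarrow> 'x measure \<Rightarrow> ('x, 'e) bsection \<Rightarrow> real" where
  "L2_norm B M f = sqrt (L2_inner B M f f)"

definition Linf_norm ::
  "('x, 'e) fibre_bundle \<Rightarrow> 'x measure \<Rightarrow> ('x, 'e) bsection \<Rightarrow> ereal" where
  "Linf_norm B M f = esssup M (\<lambda>x. ereal (fnorm B (f x)))"

definition sec_add ::
  "('x, 'e) fibre_bundle \<Rightarrow> ('x, 'e) bsection \<Rightarrow> ('x, 'e) bsection \<Rightarrow> ('x, 'e) bsection" where
  "sec_add B f g = (\<lambda>x. fplus B (f x) (g x))"

definition sec_scale ::
  "('x, 'e) fibre_bundle \<Rightarrow> real \<Rightarrow> ('x, 'e) bsection \<Rightarrow> ('x, 'e) bsection" where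
  "sec_scale B a f = (\<lambda>x. fscale B a (f x))"

definition L2_dist ::
  "('x, 'e) fibre_bundle \<Rightarrow> 'x measure \<Rightarrow> ('x, 'e) bsection \<Rightarrow> ('x, 'e) bsection \<Rightarrow> real" where
  "L2_dist B M f g = L2_norm B M (sec_add B f (sec_scale B (- 1) g))"

definition cutoff ::
  "('x, 'e) fibre_bundle \<Rightarrow> 'x set \<Rightarrow> ('x, 'e) bsection \<Rightarrow> ('x, 'e) bsection" where
  "cutoff B S f = (\<lambda>x. fscale B (indicator S x) (f x))"

text \<open>Operator norm from \<open>L2\<close> to the space normed by \<open>N\<close>.\<close>

definition op_norm_L2 ::
  "('x, 'e::topological_space) fibre_bundle \<Rightarrow> 'x measure \<Rightarrow>
   (('x, 'e) bsection \<Rightarrow> ereal) \<Rightarrow> ('x, 'e) operator \<Rightarrow> ereal" where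
  "op_norm_L2 B M N T = (SUP f \<in> {f \<in> L2 B M. L2_norm B M f \<le> 1}. N (T f))"

definition linear_operator_on ::
  "('x, 'e::topological_space) fibre_bundle \<Rightarrow> 'x measure \<Rightarrow>
   ('x, 'e) bsection set \<Rightarrow> ('x, 'e) operator \<Rightarrow> bool" where
  "linear_operator_on B M D T \<longleftrightarrow>
     D \<noteq> {} \<and> D \<subseteq> L2 B M \<and> (\<forall>f \<in> D. T f \<in> L2 B M) \<and>
     (\<forall>f \<in> D. \<forall>g \<in> L2 B M. (AE x in M. g x = f x) \<longrightarrow>
        g \<in> D \<and> (AE x in M. T g x = T f x)) \<and>
     (\<forall>f \<in> D. \<forall>g \<in> D. sec_add B f g \<in> D \<and>
        (AE x in M. T (sec_add B f g) x = sec_add B (T f) (T g) x)) \<and>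
     (\<forall>a. \<forall>f \<in> D. sec_scale B a f \<in> D \<and>
        (AE x in M. T (sec_scale B a f) x = sec_scale B a (T f) x))"

text \<open>Densely defined, symmetric, and the domain of the adjoint is contained in \<open>D\<close>.\<close>

definition self_adjoint ::
  "('x, 'e::topological_space) fibre_bundle \<Rightarrow> 'x measure \<Rightarrow>
   ('x, 'e) bsection set \<Rightarrow> ('x, 'e) operator \<Rightarrow> bool" where
  "self_adjoint B M D A \<longleftrightarrow>
     linear_operator_on B M D A \<and>
     (\<forall>f \<in> L2 B M. \<forall>\<epsilon>>0. \<exists>g \<in> D. L2_dist B M f g < \<epsilon>) \<and>
     (\<forall>f \<in> D. \<forall>g \<in> D. L2_inner B M (A f) g = L2_inner B M f (A g)) \<and>
     (\<forall>g \<in> L2 B M. \<forall>h \<in> L2 B M.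
        (\<forall>f \<in> D. L2_inner B M (A f) g = L2_inner B M f h) \<longrightarrow> g \<in> D)"

definition nonnegative_operator ::
  "('x, 'e) fibre_bundle \<Rightarrow> 'x measure \<Rightarrow>
   ('x, 'e) bsection set \<Rightarrow> ('x, 'e) operator \<Rightarrow> bool" where
  "nonnegative_operator B M D A \<longleftrightarrow> (\<forall>f \<in> D. 0 \<le> L2_inner B M (A f) f)"


section \<open>Functional calculus and heat semigroup\<close>

definition bounded_borel :: "(real \<Rightarrow> real) \<Rightarrow> bool" where
  "bounded_borel \<phi> \<longleftrightarrow> \<phi> \<in> borel_measurable borel \<and> bounded (range \<phi>)"

text \<open>\<open>\<Phi> \<phi>\<close> is \<open>\<phi>(A)\<close>. These are the properties by which the functional calculus form of the
  spectral theorem (Reed and Simon, Theorem VIII.5) characterises the bounded Borel functional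
  calculus of the self-adjoint operator \<open>A\<close> with domain \<open>D\<close>: such a \<open>\<Phi>\<close> exists and is unique up
  to equality almost everywhere.\<close>

definition borel_functional_calculus ::
  "('x, 'e::topological_space) fibre_bundle \<Rightarrow> 'x measure \<Rightarrow>
   ('x, 'e) bsection set \<Rightarrow> ('x, 'e) operator \<Rightarrow> ((real \<Rightarrow> real) \<Rightarrow> ('x, 'e) operator) \<Rightarrow> bool" where
  "borel_functional_calculus B M D A \<Phi> \<longleftrightarrow>
     (\<forall>\<phi>. bounded_borel \<phi> \<longrightarrow>
        linear_operator_on B M (L2 B M) (\<Phi> \<phi>) \<and>
        (\<forall>f \<in> L2 B M. \<forall>g \<in> L2 B M. L2_inner B M (\<Phi> \<phi> f) g = L2_inner B M f (\<Phi> \<phi> g)) \<and>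
        (\<forall>c. (\<forall>s. \<bar>\<phi> s\<bar> \<le> c) \<longrightarrow>
           (\<forall>f \<in> L2 B M. L2_norm B M (\<Phi> \<phi> f) \<le> c * L2_norm B M f))) \<and>
     (\<forall>a. \<forall>f \<in> L2 B M. AE x in M. \<Phi> (\<lambda>_. a) f x = sec_scale B a f x) \<and>
     (\<forall>\<phi> \<psi>. bounded_borel \<phi> \<and> bounded_borel \<psi> \<longrightarrow> (\<forall>f \<in> L2 B M.
        (AE x in M. \<Phi> (\<lambda>s. \<phi> s + \<psi> s) f x = sec_add B (\<Phi> \<phi> f) (\<Phi> \<psi> f) x) \<and>
        (AE x in M. \<Phi> (\<lambda>s. \<phi> s * \<psi> s) f x = \<Phi> \<phi> (\<Phi> \<psi> f) x))) \<and>
     (\<forall>h \<phi> c. (\<forall>n. bounded_borel (h n)) \<and> bounded_borel \<phi> \<and> (\<forall>n s. \<bar>h n s\<bar> \<le> c) \<and>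
        (\<forall>s. (\<lambda>n. h n s) \<longlonglongrightarrow> \<phi> s) \<longrightarrow>
        (\<forall>f \<in> L2 B M. (\<lambda>n. L2_dist B M (\<Phi> (h n) f) (\<Phi> \<phi> f)) \<longlonglongrightarrow> 0)) \<and>
     (\<forall>h. (\<forall>n::nat. bounded_borel (h n)) \<and> (\<forall>n s. \<bar>h n s\<bar> \<le> \<bar>s\<bar>) \<and>
        (\<forall>s. (\<lambda>n. h n s) \<longlonglongrightarrow> s) \<longrightarrow>
        (\<forall>f \<in> D. (\<lambda>n. L2_dist B M (\<Phi> (h n) f) (A f)) \<longlonglongrightarrow> 0))"

text \<open>The cut-off at 0 makes the function bounded and is immaterial, since the spectrum of a
  nonnegative operator lies in \<open>{0..}\<close>.\<close>

definition heat :: "((real \<Rightarrow> real) \<Rightarrow> ('x, 'e) operator) \<Rightarrow> real \<Rightarrow> ('x, 'e) operator" where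
  "heat \<Phi> t = \<Phi> (\<lambda>s. indicator {0..} s * exp (- t * s))"


section \<open>Ultracontractivity and Davies--Gaffney estimates\<close>

definition ultracontractive ::
  "('x, 'e::topological_space) fibre_bundle \<Rightarrow> 'x measure \<Rightarrow>
   ((real \<Rightarrow> real) \<Rightarrow> ('x, 'e) operator) \<Rightarrow> bool" where
  "ultracontractive B M \<Phi> \<longleftrightarrow>
     (\<forall>t>0. op_norm_L2 B M (Linf_norm B M) (heat \<Phi> t) < \<infinity>) \<and>
     (\<exists>\<alpha>>0. \<exists>C>0. \<forall>t \<in> {0<..1}.
        op_norm_L2 B M (Linf_norm B M) (heat \<Phi> t) \<le> ereal (C * t powr (- \<alpha> / 2)))"

definition davies_gaffney ::
  "('x::metric_space, 'e::topological_space) fibre_bundle \<Rightarrow> 'x measure \<Rightarrow>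
   ((real \<Rightarrow> real) \<Rightarrow> ('x, 'e) operator) \<Rightarrow> bool" where
  "davies_gaffney B M \<Phi> \<longleftrightarrow>
     (\<forall>E \<in> sets M. \<forall>F \<in> sets M. \<forall>t>0.
        op_norm_L2 B M (\<lambda>g. ereal (L2_norm B M g))
          (\<lambda>f. cutoff B F (heat \<Phi> t (cutoff B E f)))
        \<le> ereal (exp (- (setdist E F)\<^sup>2 / (4 * t))))"


section \<open>Heat kernel and local Weyl law\<close>

text \<open>\<open>w = \<integral> F(y) dM(y)\<close> in the finite-dimensional fibre over \<open>x\<close>, tested against vectors.\<close>

definition has_fibre_integral ::
  "('x, 'e) fibre_bundle \<Rightarrow> 'x measure \<Rightarrow> 'x \<Rightarrow> ('x \<Rightarrow> 'e) \<Rightarrow> 'e \<Rightarrow> bool" where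
  "has_fibre_integral B M x F w \<longleftrightarrow>
     w \<in> fibre B x \<and> (\<forall>u \<in> fibre B x.
       integrable M (\<lambda>y. finner B (F y) u) \<and> (\<integral>y. finner B (F y) u \<partial>M) = finner B w u)"

type_synonym ('x, 'e) kernel = "'x \<Rightarrow> 'x \<Rightarrow> 'e \<Rightarrow> 'e"

definition heat_kernel ::
  "('x, 'e::topological_space) fibre_bundle \<Rightarrow> 'x measure \<Rightarrow>
   ((real \<Rightarrow> real) \<Rightarrow> ('x, 'e) operator) \<Rightarrow> (real \<Rightarrow> ('x, 'e) kernel) \<Rightarrow> bool" where
  "heat_kernel B M \<Phi> p \<longleftrightarrow>
     (\<forall>t>0.
        (\<forall>x y. fibre_linear B y x (p t x y)) \<and>
        (\<forall>f \<in> borel_sections B M. (\<lambda>(x, y). p t x y (f y)) \<in> borel_measurable (M \<Otimes>\<^sub>M M)) \<and>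
        (\<exists>C. delta_AE M (\<lambda>x y. \<forall>u \<in> fibre B y. fnorm B (p t x y u) \<le> C * fnorm B u)) \<and>
        (\<forall>f \<in> L2 B M. AE x in M.
           has_fibre_integral B M x (\<lambda>y. p t x y (f y)) (heat \<Phi> t f x)) \<and>
        delta_AE M (\<lambda>x y. \<forall>u \<in> fibre B y. \<forall>v \<in> fibre B x.
           finner B (p t x y u) v = finner B u (p t y x v))) \<and>
     (\<forall>t>0. \<forall>s>0. delta_AE M (\<lambda>x y. \<forall>u \<in> fibre B y.
        has_fibre_integral B M x (\<lambda>z. p t x z (p s z y u)) (p (t + s) x y u)))"

text \<open>The operator \<open>P\<^sub>t\<^sub>,\<^sub>x\<close> from the fibre over \<open>x\<close> to \<open>L2\<close>, and its adjoint.\<close>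

definition kernel_column ::
  "(real \<Rightarrow> ('x, 'e) kernel) \<Rightarrow> real \<Rightarrow> 'x \<Rightarrow> 'e \<Rightarrow> ('x, 'e) bsection" where
  "kernel_column p t x u = (\<lambda>y. p t y x u)"

definition kernel_column_adjoint ::
  "('x, 'e) fibre_bundle \<Rightarrow> 'x measure \<Rightarrow> (real \<Rightarrow> ('x, 'e) kernel) \<Rightarrow> real \<Rightarrow> 'x \<Rightarrow>
   ('x, 'e) bsection \<Rightarrow> 'e" where
  "kernel_column_adjoint B M p t x f =
     (THE w. w \<in> fibre B x \<and>
        (\<forall>u \<in> fibre B x. finner B w u = L2_inner B M f (kernel_column p t x u)))"

text \<open>The kernel of \<open>\<phi>(A)\<close> for bounded Borel \<open>\<phi>\<close> with compact support. Up to a null set of points,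
  it does not depend on the auxiliary time \<open>t > 0\<close>.\<close>

definition calculus_kernel ::
  "('x, 'e) fibre_bundle \<Rightarrow> 'x measure \<Rightarrow> ((real \<Rightarrow> real) \<Rightarrow> ('x, 'e) operator) \<Rightarrow>
   (real \<Rightarrow> ('x, 'e) kernel) \<Rightarrow> real \<Rightarrow> (real \<Rightarrow> real) \<Rightarrow> ('x, 'e) kernel" where
  "calculus_kernel B M \<Phi> p t \<phi> x y u =
     kernel_column_adjoint B M p (t / 2) x
       (\<Phi> (\<lambda>s. \<phi> s * exp (t * s)) (kernel_column p (t / 2) y u))"

definition local_counting ::
  "('x, 'e) fibre_bundle \<Rightarrow> 'x measure \<Rightarrow> ((real \<Rightarrow> real) \<Rightarrow> ('x, 'e) operator) \<Rightarrow>
   (real \<Rightarrow> ('x, 'e) kernel) \<Rightarrow> real \<Rightarrow> 'x \<Rightarrow> real \<Rightarrow> real" where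
  "local_counting B M \<Phi> p t x \<Lambda> =
     fibre_trace B x (calculus_kernel B M \<Phi> p t (indicator {0..\<Lambda>}) x x)"

definition slowly_varying :: "(real \<Rightarrow> real) \<Rightarrow> bool" where
  "slowly_varying \<theta> \<longleftrightarrow>
     (\<forall>s\<ge>0. 0 < \<theta> s) \<and> (\<forall>a>0. ((\<lambda>s. \<theta> (a * s) / \<theta> s) \<longlongrightarrow> 1) at_top)"

text \<open>The kernel \<open>p\<close> is unique up to a change on a null set of points, and \<open>t\<close> is
  immaterial.\<close>

definition local_weyl_law ::
  "('x, 'e::topological_space) fibre_bundle \<Rightarrow> 'x measure \<Rightarrow>
   ((real \<Rightarrow> real) \<Rightarrow> ('x, 'e) operator) \<Rightarrow> bool" where
  "local_weyl_law B M \<Phi> \<longleftrightarrow>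
     (\<exists>p t. heat_kernel B M \<Phi> p \<and> 0 < t \<and>
       (\<exists>\<alpha> \<theta> c. 0 < \<alpha> \<and> slowly_varying \<theta> \<and> c \<in> borel_measurable M \<and> (\<forall>x. 0 < c x) \<and>
         (AE x in M. local_counting B M \<Phi> p t x \<sim>[at_top] (\<lambda>s. c x * s powr \<alpha> * \<theta> s))))"


section \<open>Observability and null-control\<close>

definition observability ::
  "('x, 'e::topological_space) fibre_bundle \<Rightarrow> 'x measure \<Rightarrow>
   ((real \<Rightarrow> real) \<Rightarrow> ('x, 'e) operator) \<Rightarrow> 'x set \<Rightarrow> real \<Rightarrow> real \<Rightarrow> bool" where
  "observability B M \<Phi> \<omega> T c \<longleftrightarrow>
     (\<forall>f \<in> L2 B M. (L2_norm B M (heat \<Phi> T f))\<^sup>2 \<le>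
        c * (LINT t:{0<..<T}|lborel. (L2_norm B M (cutoff B \<omega> (heat \<Phi> t f)))\<^sup>2))"

definition control_measure :: "real \<Rightarrow> 'x measure \<Rightarrow> (real \<times> 'x) measure" where
  "control_measure T M = restrict_space lborel {0<..<T} \<Otimes>\<^sub>M M"

definition controls ::
  "('x, 'e::topological_space) fibre_bundle \<Rightarrow> 'x measure \<Rightarrow> real \<Rightarrow>
   (real \<Rightarrow> ('x, 'e) bsection) set" where
  "controls B M T = {u.
     (\<lambda>(t, x). u t x) \<in> borel_measurable (control_measure T M) \<and>
     (\<forall>t x. proj B (u t x) = x) \<and>
     integrable (control_measure T M) (\<lambda>(t, x). finner B (u t x) (u t x))}"

definition control_norm ::
  "('x, 'e) fibre_bundle \<Rightarrow> 'x measure \<Rightarrow> real \<Rightarrow> (real \<Rightarrow> ('x, 'e) bsection) \<Rightarrow> real" where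
  "control_norm B M T u =
     sqrt (\<integral>(t, x). finner B (u t x) (u t x) \<partial>control_measure T M)"

text \<open>Mild (Duhamel) solutions of \<open>\<partial>\<^sub>t y + A y = 1\<^sub>\<omega> u\<close> with \<open>y(0) = y\<^sub>0\<close>; the integral with
  values in \<open>L2\<close> is tested against elements of \<open>L2\<close>, using that the semigroup is symmetric.\<close>

definition mild_solution ::
  "('x, 'e::topological_space) fibre_bundle \<Rightarrow> 'x measure \<Rightarrow>
   ((real \<Rightarrow> real) \<Rightarrow> ('x, 'e) operator) \<Rightarrow> 'x set \<Rightarrow> real \<Rightarrow>
   ('x, 'e) bsection \<Rightarrow> (real \<Rightarrow> ('x, 'e) bsection) \<Rightarrow> (real \<Rightarrow> ('x, 'e) bsection) \<Rightarrow> bool" where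
  "mild_solution B M \<Phi> \<omega> T y0 u y \<longleftrightarrow>
     (\<forall>t \<in> {0..T}. y t \<in> L2 B M \<and>
        (\<forall>g \<in> L2 B M. L2_inner B M (y t) g =
           L2_inner B M (heat \<Phi> t y0) g +
           (LINT s:{0<..<t}|lborel. L2_inner B M (cutoff B \<omega> (u s)) (heat \<Phi> (t - s) g))))"

definition null_controllable_with_cost ::
  "('x, 'e::topological_space) fibre_bundle \<Rightarrow> 'x measure \<Rightarrow>
   ((real \<Rightarrow> real) \<Rightarrow> ('x, 'e) operator) \<Rightarrow> 'x set \<Rightarrow> real \<Rightarrow> real \<Rightarrow> bool" where
  "null_controllable_with_cost B M \<Phi> \<omega> T c \<longleftrightarrow>
     (\<forall>y0 \<in> L2 B M. \<exists>u \<in> controls B M T. \<exists>y.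
        mild_solution B M \<Phi> \<omega> T y0 u y \<and> L2_norm B M (y T) = 0 \<and>
        control_norm B M T u \<le> c * L2_norm B M y0)"

text \<open>Both infima are \<open>\<infinity>\<close> when the set is empty.\<close>

definition control_cost ::
  "('x, 'e::topological_space) fibre_bundle \<Rightarrow> 'x measure \<Rightarrow>
   ((real \<Rightarrow> real) \<Rightarrow> ('x, 'e) operator) \<Rightarrow> 'x set \<Rightarrow> real \<Rightarrow> ennreal" where
  "control_cost B M \<Phi> \<omega> T =
     (INF c \<in> {c. 0 \<le> c \<and> null_controllable_with_cost B M \<Phi> \<omega> T c}. ennreal c)"

definition heat_control_rate ::
  "('x, 'e::topological_space) fibre_bundle \<Rightarrow> 'x measure \<Rightarrow>
   ((real \<Rightarrow> real) \<Rightarrow> ('x, 'e) operator) \<Rightarrow> 'x set \<Rightarrow> ennreal" where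
  "heat_control_rate B M \<Phi> \<omega> =
     (INF K \<in> {K. 0 < K \<and> (\<exists>C>0. \<exists>T0>0. \<forall>T \<in> {0<..T0}.
        control_cost B M \<Phi> \<omega> T \<le> ennreal (C * exp (K / T)))}. ennreal K)"

end

theory Submission
  imports Defs
begin

text \<open>Fix a ball of radius \<open>r\<close> that meets \<open>\<omega>\<close> in a null set, and a normalised section \<open>f\<close>
  supported in a small concentric ball, so at distance at least \<open>d\<close> from the essential part of
  \<open>\<omega>\<close>, where \<open>d\<close> is as close to \<open>r\<close> as desired. By the Davies--Gaffney estimate the squared mass
  of \<open>e\<^sup>-\<^sup>t\<^sup>A f\<close> in \<open>\<omega>\<close> is at most \<open>exp (- d\<^sup>2 / (2 t))\<close>. On the other hand
  \<open>\<parallel>e\<^sup>-\<^sup>T\<^sup>A f\<parallel>\<^sup>2 = \<langle>e\<^sup>-\<^sup>2\<^sup>T\<^sup>A f, f\<rangle>\<close> tends to 1 as \<open>T\<close> tends to 0, so the observability constant must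
  compensate \<open>exp (- d\<^sup>2 / (2 T))\<close>. For the control cost, the solution that starts at \<open>f\<close> is tested
  against \<open>f\<close> itself: the control has to cancel \<open>\<langle>e\<^sup>-\<^sup>T\<^sup>A f, f\<rangle>\<close>, but acts only through
  \<open>1\<^sub>\<omega> e\<^sup>-\<^sup>(\<^sup>T\<^sup>-\<^sup>s\<^sup>)\<^sup>A f\<close>, whose norm is at most \<open>exp (- d\<^sup>2 / (4 T))\<close>.\<close>

text \<open>Measurability of \<open>h\<close> is not required, since a non-integrable function has integral 0.\<close>

lemma abs_integral_le_of_AE_bound:
  fixes h g :: "'a \<Rightarrow> real"
  assumes "integrable M g" and "AE x in M. \<bar>h x\<bar> \<le> g x"
  shows "\<bar>\<integral>x. h x \<partial>M\<bar> \<le> (\<integral>x. g x \<partial>M)"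
proof (cases "integrable M h")
  case True
  have "\<bar>\<integral>x. h x \<partial>M\<bar> \<le> (\<integral>x. \<bar>h x\<bar> \<partial>M)" by (rule integral_abs_bound)
  also have "\<dots> \<le> (\<integral>x. g x \<partial>M)"
    using True assms by (intro integral_mono_AE) auto
  finally show ?thesis .
next
  case False
  have "0 \<le> (\<integral>x. g x \<partial>M)"
    using assms(2) by (intro integral_nonneg_AE) auto
  then show ?thesis using False by (simp add: not_integrable_integral_eq)
qed

section \<open>Fibrewise algebra in a Euclidean vector bundle\<close>

locale euclidean_bundle =
  fixes B :: "('x::topological_space, 'e::topological_space) fibre_bundle"
    and F :: "'f::euclidean_space itself"
  assumes euclidean_bundle: "euclidean_vector_bundle F B"
begin

lemma vector_bundle: "vector_bundle F B"
  and inner_product: "fibre_inner_product B"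
  using euclidean_bundle by (auto simp: euclidean_vector_bundle_def)

lemma proj_fplus [simp]: "proj B u = proj B v \<Longrightarrow> proj B (fplus B u v) = proj B v"
  and proj_fscale [simp]: "proj B (fscale B a v) = proj B v"
  using vector_bundle unfolding vector_bundle_def by blast+

lemma local_trivialisation:
  obtains U \<tau> \<sigma> where "open U" "x \<in> U"
    "homeomorphism (proj B -` U) (U \<times> (UNIV :: 'f set)) \<tau> \<sigma>"
    "\<And>v. v \<in> proj B -` U \<Longrightarrow> fst (\<tau> v) = proj B v"
    "\<And>a v. v \<in> proj B -` U \<Longrightarrow> snd (\<tau> (fscale B a v)) = a *\<^sub>R snd (\<tau> v)"
proof -
  have "\<exists>U \<tau> \<sigma>. open U \<and> x \<in> U \<and>
        homeomorphism (proj B -` U) (U \<times> (UNIV :: 'f set)) \<tau> \<sigma> \<and>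
        (\<forall>v \<in> proj B -` U. fst (\<tau> v) = proj B v) \<and>
        (\<forall>u \<in> proj B -` U. \<forall>v \<in> proj B -` U. proj B u = proj B v \<longrightarrow>
           snd (\<tau> (fplus B u v)) = snd (\<tau> u) + snd (\<tau> v)) \<and>
        (\<forall>a. \<forall>v \<in> proj B -` U. snd (\<tau> (fscale B a v)) = a *\<^sub>R snd (\<tau> v))"
    using vector_bundle unfolding vector_bundle_def by (elim conjE allE[of _ x])
  then show ?thesis using that by (elim exE conjE) simp
qed

text \<open>The vector space laws on the fibres are not axioms but consequences of the
  trivialisations: both sides have the same image under \<open>\<tau>\<close>, and
  \<open>\<sigma>\<close> inverts \<open>\<tau>\<close>.\<close>

lemma fscale_fscale [simp]: "fscale B a (fscale B b v) = fscale B (a * b) v"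
proof -
  obtain U \<tau> \<sigma> where U: "proj B v \<in> U"
    "homeomorphism (proj B -` U) (U \<times> (UNIV :: 'f set)) \<tau> \<sigma>"
    "\<And>v. v \<in> proj B -` U \<Longrightarrow> fst (\<tau> v) = proj B v"
    "\<And>a v. v \<in> proj B -` U \<Longrightarrow> snd (\<tau> (fscale B a v)) = a *\<^sub>R snd (\<tau> v)"
    by (rule local_trivialisation[of "proj B v"]) blast
  have "\<tau> (fscale B a (fscale B b v)) = \<tau> (fscale B (a * b) v)"
    using U(1) by (intro prod_eqI) (simp_all add: U(3,4))
  then have "\<sigma> (\<tau> (fscale B a (fscale B b v))) = \<sigma> (\<tau> (fscale B (a * b) v))" by simp
  then show ?thesis using U(1) homeomorphism_apply1[OF U(2)] by simp
qed

lemma fscale_one [simp]: "fscale B 1 v = v"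
proof -
  obtain U \<tau> \<sigma> where U: "proj B v \<in> U"
    "homeomorphism (proj B -` U) (U \<times> (UNIV :: 'f set)) \<tau> \<sigma>"
    "\<And>v. v \<in> proj B -` U \<Longrightarrow> fst (\<tau> v) = proj B v"
    "\<And>a v. v \<in> proj B -` U \<Longrightarrow> snd (\<tau> (fscale B a v)) = a *\<^sub>R snd (\<tau> v)"
    by (rule local_trivialisation[of "proj B v"]) blast
  have "\<tau> (fscale B 1 v) = \<tau> v"
    using U(1) by (intro prod_eqI) (simp_all add: U(3,4))
  then have "\<sigma> (\<tau> (fscale B 1 v)) = \<sigma> (\<tau> v)" by simp
  then show ?thesis using U(1) homeomorphism_apply1[OF U(2)] by simp
qed

lemma finner_commute: "proj B u = proj B v \<Longrightarrow> finner B u v = finner B v u"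
  and finner_fplus_left: "\<lbrakk>proj B u = proj B w; proj B v = proj B w\<rbrakk> \<Longrightarrow>
        finner B (fplus B u v) w = finner B u w + finner B v w"
  and finner_fscale_left: "proj B u = proj B v \<Longrightarrow> finner B (fscale B a u) v = a * finner B u v"
  and finner_pos: "v \<noteq> fscale B 0 v \<Longrightarrow> 0 < finner B v v"
  and finner_measurable: "(\<lambda>(u, v). finner B u v)
       \<in> borel_measurable (restrict_space borel {(u, v). proj B u = proj B v})"
  using inner_product unfolding fibre_inner_product_def by blast+

lemma finner_fplus_right: "\<lbrakk>proj B u = proj B w; proj B v = proj B w\<rbrakk> \<Longrightarrow>
    finner B w (fplus B u v) = finner B w u + finner B w v"
  using finner_commute[of w "fplus B u v"] finner_commute[of w u] finner_commute[of w v]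
  by (simp add: finner_fplus_left)

lemma finner_fscale_right: "proj B u = proj B v \<Longrightarrow> finner B v (fscale B a u) = a * finner B v u"
  using finner_commute[of v "fscale B a u"] finner_commute[of v u]
  by (simp add: finner_fscale_left)

lemmas finner_simps = finner_fplus_left finner_fplus_right finner_fscale_left finner_fscale_right

lemma finner_nonneg [simp]: "0 \<le> finner B v v"
proof (cases "v = fscale B 0 v")
  case True
  have "finner B v v = finner B (fscale B 0 v) v" using True by simp
  also have "\<dots> = 0" by (simp add: finner_fscale_left)
  finally show ?thesis by simp
qed (simp add: finner_pos less_imp_le)

text \<open>Young's inequality: expand the squared norm of \<open>a u + e v\<close> for
  \<open>e = 1\<close> and \<open>e = - 1\<close>, then divide by \<open>a\<close>. The weight
  \<open>a\<close> stays free until \<open>null_control_lower_bound\<close> fixes it.\<close>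

lemma abs_finner_le:
  assumes "proj B u = proj B v" and "0 < a"
  shows "\<bar>finner B u v\<bar> \<le> (a * finner B u u + finner B v v / a) / 2"
proof -
  have *: "0 \<le> a * finner B u u + 2 * e * finner B u v + finner B v v / a" if "e\<^sup>2 = 1" for e
  proof -
    have "0 \<le> finner B (fplus B (fscale B a u) (fscale B e v)) (fplus B (fscale B a u) (fscale B e v))"
      by simp
    also have "\<dots> = a\<^sup>2 * finner B u u + 2 * a * e * finner B u v + e\<^sup>2 * finner B v v"
      using assms(1) finner_commute[OF assms(1)]
      by (simp add: finner_simps power2_eq_square algebra_simps)
    also have "\<dots> = a * (a * finner B u u + 2 * e * finner B u v + finner B v v / a)"
      using assms(2) that by (simp add: power2_eq_square field_simps)
    finally show ?thesis using assms(2) by (simp add: zero_le_mult_iff)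
  qed
  show ?thesis using *[of 1] *[of "-1"] by (simp add: abs_le_iff)
qed

lemma finner_cutoff_left:
  "proj B (f x) = proj B v \<Longrightarrow> finner B (cutoff B S f x) v = indicator S x * finner B (f x) v"
  by (simp add: cutoff_def finner_fscale_left)

lemma finner_cutoff_cutoff:
  "finner B (cutoff B S f x) (cutoff B S f x) = indicator S x * finner B (f x) (f x)"
  by (simp add: cutoff_def finner_simps indicator_def)

end

section \<open>Square integrable sections as a semi-inner product space\<close>

locale L2_sections = euclidean_bundle B F
  for B :: "('x::topological_space, 'e::topological_space) fibre_bundle"
    and F :: "'f::euclidean_space itself" +
  fixes M :: "'x measure"
  assumes L2_nonempty: "L2 B M \<noteq> {}"
    and L2_add: "\<lbrakk>f \<in> L2 B M; g \<in> L2 B M\<rbrakk> \<Longrightarrow> sec_add B f g \<in> L2 B M"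
    and L2_scale: "f \<in> L2 B M \<Longrightarrow> sec_scale B a f \<in> L2 B M"
begin

abbreviation "H \<equiv> L2 B M"
abbreviation ip (infix "\<bullet>\<^sub>H" 70) where "f \<bullet>\<^sub>H g \<equiv> L2_inner B M f g"

lemma L2_proj [simp]: "f \<in> H \<Longrightarrow> proj B (f x) = x"
  by (simp add: L2_def borel_sections_def)

lemma L2_measurable: "f \<in> H \<Longrightarrow> f \<in> borel_measurable M"
  unfolding L2_def borel_sections_def by blast

lemma L2_integrable_self: "f \<in> H \<Longrightarrow> integrable M (\<lambda>x. finner B (f x) (f x))"
  by (simp add: L2_def)

text \<open>By polarisation: the pairing need not be measurable a priori, because the Borel sets of
  \<open>'e \<times> 'e\<close> may exceed the product \<open>\<sigma>\<close>-algebra.\<close>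

lemma L2_integrable:
  assumes "f \<in> H" "g \<in> H"
  shows "integrable M (\<lambda>x. finner B (f x) (g x))"
proof -
  have "integrable M (\<lambda>x. finner B (sec_add B f g x) (sec_add B f g x)
      - finner B (f x) (f x) - finner B (g x) (g x))"
    using assms by (intro Bochner_Integration.integrable_diff L2_integrable_self L2_add)
  then have "integrable M (\<lambda>x. 2 * finner B (f x) (g x))"
    using assms finner_commute[of "f _" "g _"] by (simp add: sec_add_def finner_simps)
  then show ?thesis by simp
qed

lemma L2_inner_commute: "\<lbrakk>f \<in> H; g \<in> H\<rbrakk> \<Longrightarrow> f \<bullet>\<^sub>H g = g \<bullet>\<^sub>H f"
  unfolding L2_inner_def by (intro Bochner_Integration.integral_cong finner_commute) auto

lemma L2_inner_add_left:
  "\<lbrakk>f \<in> H; g \<in> H; h \<in> H\<rbrakk> \<Longrightarrow> sec_add B f g \<bullet>\<^sub>H h = f \<bullet>\<^sub>H h + g \<bullet>\<^sub>H h"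
  by (simp add: L2_inner_def sec_add_def finner_simps L2_integrable)

lemma L2_inner_scale_left:
  "\<lbrakk>f \<in> H; g \<in> H\<rbrakk> \<Longrightarrow> sec_scale B a f \<bullet>\<^sub>H g = a * (f \<bullet>\<^sub>H g)"
  by (simp add: L2_inner_def sec_scale_def finner_simps)

lemma L2_inner_add_right:
  "\<lbrakk>f \<in> H; g \<in> H; h \<in> H\<rbrakk> \<Longrightarrow> h \<bullet>\<^sub>H sec_add B f g = h \<bullet>\<^sub>H f + h \<bullet>\<^sub>H g"
  by (simp add: L2_inner_def sec_add_def finner_simps L2_integrable)

lemma L2_inner_scale_right:
  "\<lbrakk>f \<in> H; g \<in> H\<rbrakk> \<Longrightarrow> g \<bullet>\<^sub>H sec_scale B a f = a * (g \<bullet>\<^sub>H f)"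
  by (simp add: L2_inner_def sec_scale_def finner_simps)

lemma L2_inner_cong_AE:
  assumes "f \<in> H" "f' \<in> H" "g \<in> H" "AE x in M. f x = f' x"
  shows "f \<bullet>\<^sub>H g = f' \<bullet>\<^sub>H g"
  unfolding L2_inner_def
  using assms by (intro integral_cong_AE borel_measurable_integrable L2_integrable) auto

lemma L2_inner_nonneg [simp]: "0 \<le> f \<bullet>\<^sub>H f"
  by (simp add: L2_inner_def)

lemma L2_norm_nonneg [simp]: "0 \<le> L2_norm B M f"
  by (simp add: L2_norm_def)

lemma L2_norm_power2: "(L2_norm B M f)\<^sup>2 = f \<bullet>\<^sub>H f"
  by (simp add: L2_norm_def)

text \<open>The usual discriminant argument. Sections are functions rather than classes, so the form
  is only semidefinite and the case \<open>g \<bullet>\<^sub>H g = 0\<close> needs its own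
  treatment.\<close>

lemma L2_Cauchy_Schwarz:
  assumes f: "f \<in> H" and g: "g \<in> H"
  shows "\<bar>f \<bullet>\<^sub>H g\<bar> \<le> L2_norm B M f * L2_norm B M g"
proof -
  have q: "0 \<le> f \<bullet>\<^sub>H f + 2 * t * (f \<bullet>\<^sub>H g) + t\<^sup>2 * (g \<bullet>\<^sub>H g)" for t
  proof -
    let ?h = "sec_add B f (sec_scale B t g)"
    have "?h \<bullet>\<^sub>H ?h = f \<bullet>\<^sub>H f + 2 * t * (f \<bullet>\<^sub>H g) + t\<^sup>2 * (g \<bullet>\<^sub>H g)"
      using f g L2_inner_commute[OF f g]
      by (simp add: L2_add L2_scale L2_inner_add_left L2_inner_add_right L2_inner_scale_left
          L2_inner_scale_right power2_eq_square algebra_simps)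
    then show ?thesis using L2_inner_nonneg[of ?h] by linarith
  qed
  have "(f \<bullet>\<^sub>H g)\<^sup>2 \<le> (f \<bullet>\<^sub>H f) * (g \<bullet>\<^sub>H g)"
  proof (cases "g \<bullet>\<^sub>H g = 0")
    case True
    have "f \<bullet>\<^sub>H g = 0"
    proof (rule ccontr)
      assume "f \<bullet>\<^sub>H g \<noteq> 0"
      \<comment> \<open>Since \<open>g \<bullet>\<^sub>H g = 0\<close>, the quadratic in
        \<open>q\<close> is affine in \<open>t\<close>, and at this \<open>t\<close> it takes the
        value \<open>- 1\<close>.\<close>
      then show False
        using q[of "- (f \<bullet>\<^sub>H f + 1) / (2 * (f \<bullet>\<^sub>H g))"] True by (simp add: field_simps)
    qed
    then show ?thesis using True by simp
  next
    case False
    then have pos: "0 < g \<bullet>\<^sub>H g" using L2_inner_nonneg[of g] by linarith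
    \<comment> \<open>This is \<open>q\<close> at its minimiser in \<open>t\<close>, multiplied by
      \<open>g \<bullet>\<^sub>H g\<close>.\<close>
    have "0 \<le> (g \<bullet>\<^sub>H g) * (f \<bullet>\<^sub>H f + 2 * (- (f \<bullet>\<^sub>H g) / (g \<bullet>\<^sub>H g)) * (f \<bullet>\<^sub>H g)
        + (- (f \<bullet>\<^sub>H g) / (g \<bullet>\<^sub>H g))\<^sup>2 * (g \<bullet>\<^sub>H g))"
      by (rule mult_nonneg_nonneg[OF less_imp_le[OF pos] q])
    also have "\<dots> = (f \<bullet>\<^sub>H f) * (g \<bullet>\<^sub>H g) - (f \<bullet>\<^sub>H g)\<^sup>2"
      using pos by (simp add: field_simps power2_eq_square)
    finally show ?thesis by simp
  qed
  then have "sqrt ((f \<bullet>\<^sub>H g)\<^sup>2) \<le> sqrt ((f \<bullet>\<^sub>H f) * (g \<bullet>\<^sub>H g))" by (rule real_sqrt_le_mono)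
  then show ?thesis by (simp add: L2_norm_def real_sqrt_mult)
qed

text \<open>Norm convergence implies weak convergence by Cauchy--Schwarz. Limits in the functional
  calculus are thereby reduced to limits of real numbers.\<close>

lemma L2_inner_tendsto:
  assumes "\<And>n. f n \<in> H" "l \<in> H" "g \<in> H" "(\<lambda>n. L2_dist B M (f n) l) \<longlonglongrightarrow> 0"
  shows "(\<lambda>n. f n \<bullet>\<^sub>H g) \<longlonglongrightarrow> l \<bullet>\<^sub>H g"
proof -
  have "\<bar>f n \<bullet>\<^sub>H g - l \<bullet>\<^sub>H g\<bar> \<le> L2_dist B M (f n) l * L2_norm B M g" for n
    using L2_Cauchy_Schwarz[of "sec_add B (f n) (sec_scale B (- 1) l)" g] assms(1-3)
    by (simp add: L2_dist_def L2_add L2_scale L2_inner_add_left L2_inner_scale_left)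
  moreover have "(\<lambda>n. L2_dist B M (f n) l * L2_norm B M g) \<longlonglongrightarrow> 0"
    using tendsto_mult_right[OF assms(4), of "L2_norm B M g"] by simp
  ultimately have "(\<lambda>n. f n \<bullet>\<^sub>H g - l \<bullet>\<^sub>H g) \<longlonglongrightarrow> 0"
    by (elim Lim_null_comparison[rotated]) simp
  then show ?thesis by (simp add: LIM_zero_iff)
qed

lemma L2_inner_cutoff:
  "cutoff B S f \<bullet>\<^sub>H cutoff B S f = (\<integral>x. indicator S x * finner B (f x) (f x) \<partial>M)"
  by (simp add: L2_inner_def finner_cutoff_cutoff)

end

section \<open>The bounded Borel functional calculus, read through inner products\<close>

locale nonnegative_calculus = euclidean_bundle B F
  for B :: "('x::topological_space, 'e::topological_space) fibre_bundle"
    and F :: "'f::euclidean_space itself" +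
  fixes M :: "'x measure"
    and D :: "('x \<Rightarrow> 'e) set"
    and A :: "('x \<Rightarrow> 'e) \<Rightarrow> ('x \<Rightarrow> 'e)"
    and \<Phi> :: "(real \<Rightarrow> real) \<Rightarrow> ('x \<Rightarrow> 'e) \<Rightarrow> ('x \<Rightarrow> 'e)"
  assumes self_adjoint: "self_adjoint B M D A"
    and nonnegative: "nonnegative_operator B M D A"
    and calculus: "borel_functional_calculus B M D A \<Phi>"
begin

lemma calculus_linear: "bounded_borel \<phi> \<Longrightarrow> linear_operator_on B M (L2 B M) (\<Phi> \<phi>)"
  using calculus unfolding borel_functional_calculus_def by blast

lemma bounded_borel_const [simp]: "bounded_borel (\<lambda>_. a)"
  by (auto simp: bounded_borel_def bounded_iff)

text \<open>\<open>linear_operator_on\<close> with full domain contains that \<open>L2\<close> is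
  nonempty and closed under sums and multiples. Applied to the single operator
  \<open>\<Phi> (\<lambda>_. 0)\<close>, it yields these closure properties without a measurability
  argument for the fibre operations.\<close>

sublocale L2_sections B F M
  using calculus_linear[OF bounded_borel_const[of 0]]
  by unfold_locales (auto simp: linear_operator_on_def)

lemma calculus_closed [simp]: "\<lbrakk>bounded_borel \<phi>; f \<in> H\<rbrakk> \<Longrightarrow> \<Phi> \<phi> f \<in> H"
  using calculus_linear[of \<phi>] by (simp add: linear_operator_on_def)

lemma calculus_symmetric:
  "\<lbrakk>bounded_borel \<phi>; f \<in> H; g \<in> H\<rbrakk> \<Longrightarrow> \<Phi> \<phi> f \<bullet>\<^sub>H g = f \<bullet>\<^sub>H \<Phi> \<phi> g"
  using calculus unfolding borel_functional_calculus_def by blast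

lemma bounded_borel_add:
  "\<lbrakk>bounded_borel \<phi>; bounded_borel \<psi>\<rbrakk> \<Longrightarrow> bounded_borel (\<lambda>s. \<phi> s + \<psi> s)"
  by (auto simp: bounded_borel_def intro: bounded_plus_comp)

lemma bounded_borel_mult:
  assumes "bounded_borel \<phi>" "bounded_borel \<psi>"
  shows "bounded_borel (\<lambda>s. \<phi> s * \<psi> s)"
proof -
  obtain a b where "\<And>s. \<bar>\<phi> s\<bar> \<le> a" "\<And>s. \<bar>\<psi> s\<bar> \<le> b"
    using assms by (auto simp: bounded_borel_def bounded_iff)
  then have "\<bar>\<phi> s * \<psi> s\<bar> \<le> a * b" for s
    unfolding abs_mult by (meson abs_ge_zero mult_mono order_trans)
  then show ?thesis using assms by (auto simp: bounded_borel_def bounded_iff)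
qed

text \<open>The rules of the calculus hold almost everywhere; pairing with \<open>g\<close> absorbs
  the exceptional null set and leaves an equation between reals. The rules for products and
  constants are treated alike.\<close>

lemma calculus_add:
  assumes "bounded_borel \<phi>" "bounded_borel \<psi>" "f \<in> H" "g \<in> H"
  shows "\<Phi> (\<lambda>s. \<phi> s + \<psi> s) f \<bullet>\<^sub>H g = \<Phi> \<phi> f \<bullet>\<^sub>H g + \<Phi> \<psi> f \<bullet>\<^sub>H g"
proof -
  have "AE x in M. \<Phi> (\<lambda>s. \<phi> s + \<psi> s) f x = sec_add B (\<Phi> \<phi> f) (\<Phi> \<psi> f) x"
    using calculus assms unfolding borel_functional_calculus_def by blast
  then have "\<Phi> (\<lambda>s. \<phi> s + \<psi> s) f \<bullet>\<^sub>H g = sec_add B (\<Phi> \<phi> f) (\<Phi> \<psi> f) \<bullet>\<^sub>H g"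
    using assms by (intro L2_inner_cong_AE) (auto simp: bounded_borel_add L2_add)
  then show ?thesis using assms by (simp add: L2_inner_add_left)
qed

lemma calculus_mult:
  assumes "bounded_borel \<phi>" "bounded_borel \<psi>" "f \<in> H" "g \<in> H"
  shows "\<Phi> (\<lambda>s. \<phi> s * \<psi> s) f \<bullet>\<^sub>H g = \<Phi> \<phi> (\<Phi> \<psi> f) \<bullet>\<^sub>H g"
proof -
  have "AE x in M. \<Phi> (\<lambda>s. \<phi> s * \<psi> s) f x = \<Phi> \<phi> (\<Phi> \<psi> f) x"
    using calculus assms unfolding borel_functional_calculus_def by blast
  then show ?thesis
    using assms by (intro L2_inner_cong_AE) (auto simp: bounded_borel_mult)
qed

lemma calculus_const:
  assumes "f \<in> H" "g \<in> H"
  shows "\<Phi> (\<lambda>_. a) f \<bullet>\<^sub>H g = a * (f \<bullet>\<^sub>H g)"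
proof -
  have "AE x in M. \<Phi> (\<lambda>_. a) f x = sec_scale B a f x"
    using calculus assms unfolding borel_functional_calculus_def by blast
  then have "\<Phi> (\<lambda>_. a) f \<bullet>\<^sub>H g = sec_scale B a f \<bullet>\<^sub>H g"
    using assms by (intro L2_inner_cong_AE) (auto simp: L2_scale)
  then show ?thesis using assms by (simp add: L2_inner_scale_left)
qed

lemma calculus_scale:
  assumes "bounded_borel \<phi>" "f \<in> H" "g \<in> H"
  shows "\<Phi> (\<lambda>s. a * \<phi> s) f \<bullet>\<^sub>H g = a * (\<Phi> \<phi> f \<bullet>\<^sub>H g)"
  using calculus_mult[OF bounded_borel_const assms] assms by (simp add: calculus_const)

lemma calculus_tendsto:
  assumes "\<And>n. bounded_borel (h n)" "bounded_borel \<phi>" "\<And>n s. \<bar>h n s\<bar> \<le> c"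
    "\<And>s. (\<lambda>n. h n s) \<longlonglongrightarrow> \<phi> s" "f \<in> H" "g \<in> H"
  shows "(\<lambda>n. \<Phi> (h n) f \<bullet>\<^sub>H g) \<longlonglongrightarrow> \<Phi> \<phi> f \<bullet>\<^sub>H g"
proof (rule L2_inner_tendsto)
  have "(\<forall>h \<phi> c. (\<forall>n. bounded_borel (h n)) \<and> bounded_borel \<phi> \<and> (\<forall>n s. \<bar>h n s\<bar> \<le> c) \<and>
        (\<forall>s. (\<lambda>n. h n s) \<longlonglongrightarrow> \<phi> s) \<longrightarrow>
        (\<forall>f \<in> L2 B M. (\<lambda>n. L2_dist B M (\<Phi> (h n) f) (\<Phi> \<phi> f)) \<longlonglongrightarrow> 0))"
    using calculus unfolding borel_functional_calculus_def by (elim conjE)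
  then show "(\<lambda>n. L2_dist B M (\<Phi> (h n) f) (\<Phi> \<phi> f)) \<longlonglongrightarrow> 0"
    using assms by blast
qed (use assms in auto)

text \<open>With \<open>\<psi>\<close> the square root of \<open>\<phi>\<close>, multiplicativity
  and symmetry turn the form into the squared norm of \<open>\<Phi> \<psi> f\<close>.\<close>

lemma calculus_nonneg:
  assumes "bounded_borel \<phi>" "\<And>s. 0 \<le> \<phi> s" "f \<in> H"
  shows "0 \<le> \<Phi> \<phi> f \<bullet>\<^sub>H f"
proof -
  let ?\<psi> = "\<lambda>s. sqrt (\<phi> s)"
  obtain c where c: "\<And>s. \<bar>\<phi> s\<bar> \<le> c"
    using assms by (auto simp: bounded_borel_def bounded_iff)
  have "\<bar>?\<psi> s\<bar> \<le> sqrt c" for s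
    using c[of s] assms(2)[of s] by simp
  then have \<psi>: "bounded_borel ?\<psi>"
    using assms(1) by (auto simp: bounded_borel_def bounded_iff)
  have "(\<lambda>s. ?\<psi> s * ?\<psi> s) = \<phi>"
    using assms(2) by auto
  then have "\<Phi> \<phi> f \<bullet>\<^sub>H f = \<Phi> ?\<psi> (\<Phi> ?\<psi> f) \<bullet>\<^sub>H f"
    using calculus_mult[OF \<psi> \<psi> assms(3) assms(3)] by (simp only:)
  also have "\<dots> = \<Phi> ?\<psi> f \<bullet>\<^sub>H \<Phi> ?\<psi> f"
    using \<psi> assms(3) by (intro calculus_symmetric) auto
  finally show ?thesis by simp
qed

lemma calculus_mono:
  assumes "bounded_borel \<phi>" "bounded_borel \<psi>" "\<And>s. \<phi> s \<le> \<psi> s" "f \<in> H"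
  shows "\<Phi> \<phi> f \<bullet>\<^sub>H f \<le> \<Phi> \<psi> f \<bullet>\<^sub>H f"
proof -
  have m: "bounded_borel (\<lambda>s. - 1 * \<phi> s)"
    by (rule bounded_borel_mult[OF bounded_borel_const assms(1)])
  have "0 \<le> \<Phi> (\<lambda>s. \<psi> s + - 1 * \<phi> s) f \<bullet>\<^sub>H f"
    using assms by (intro calculus_nonneg bounded_borel_add m) auto
  also have "\<dots> = \<Phi> \<psi> f \<bullet>\<^sub>H f + - 1 * (\<Phi> \<phi> f \<bullet>\<^sub>H f)"
    unfolding calculus_add[OF assms(2) m assms(4,4)] calculus_scale[OF assms(1,4,4)] ..
  finally show ?thesis by simp
qed

section \<open>The generator on bounded spectral subspaces, and the absence of negative
  spectrum\<close>

lemma domain_L2 [simp]: "f \<in> D \<Longrightarrow> f \<in> H"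
  and generator_closed [simp]: "f \<in> D \<Longrightarrow> A f \<in> H"
  using self_adjoint by (auto simp: self_adjoint_def linear_operator_on_def)

lemma domainI:
  assumes "g \<in> H" "h \<in> H" "\<And>f. f \<in> D \<Longrightarrow> A f \<bullet>\<^sub>H g = f \<bullet>\<^sub>H h"
  shows "g \<in> D"
  using self_adjoint assms unfolding self_adjoint_def by blast

text \<open>The calculus reaches the unbounded operator \<open>A\<close> only as a limit along
  bounded functions that tend to the identity and are dominated by \<open>\<bar>s\<bar>\<close>;
  truncation provides such a sequence.\<close>

definition clip :: "nat \<Rightarrow> real \<Rightarrow> real" where
  "clip n s = max (- real n) (min (real n) s)"

lemma clip_eq: "\<bar>s\<bar> \<le> real n \<Longrightarrow> clip n s = s"
  by (auto simp: clip_def)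

lemma bounded_borel_clip [simp]: "bounded_borel (clip n)"
proof -
  have "\<bar>clip n s\<bar> \<le> real n" for s by (auto simp: clip_def)
  moreover have "clip n \<in> borel_measurable borel" unfolding clip_def by measurable
  ultimately show ?thesis by (auto simp: bounded_borel_def bounded_iff)
qed

lemma clip_tendsto: "(\<lambda>n. clip n s) \<longlonglongrightarrow> s"
proof (rule tendsto_eventually)
  show "\<forall>\<^sub>F n in sequentially. clip n s = s"
    using eventually_ge_at_top[of "nat \<lceil>\<bar>s\<bar>\<rceil>"]
    by eventually_elim (rule clip_eq, linarith)
qed

lemma generator_tendsto:
  assumes "f \<in> D" "g \<in> H"
  shows "(\<lambda>n. \<Phi> (clip n) f \<bullet>\<^sub>H g) \<longlonglongrightarrow> A f \<bullet>\<^sub>H g"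
proof (rule L2_inner_tendsto)
  have "(\<forall>h. (\<forall>n::nat. bounded_borel (h n)) \<and> (\<forall>n s. \<bar>h n s\<bar> \<le> \<bar>s\<bar>) \<and>
        (\<forall>s. (\<lambda>n. h n s) \<longlonglongrightarrow> s) \<longrightarrow>
        (\<forall>f \<in> D. (\<lambda>n. L2_dist B M (\<Phi> (h n) f) (A f)) \<longlonglongrightarrow> 0))"
    using calculus unfolding borel_functional_calculus_def by (elim conjE)
  moreover have "\<bar>clip n s\<bar> \<le> \<bar>s\<bar>" for n s by (auto simp: clip_def)
  ultimately show "(\<lambda>n. L2_dist B M (\<Phi> (clip n) f) (A f)) \<longlonglongrightarrow> 0"
    using assms clip_tendsto bounded_borel_clip by blast
qed (use assms in auto)

lemma clip_calculus:
  assumes "bounded_borel \<phi>" "\<And>s. \<phi> s \<noteq> 0 \<Longrightarrow> \<bar>s\<bar> \<le> real n" "f \<in> H" "g \<in> H"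
  shows "\<Phi> (clip n) (\<Phi> \<phi> f) \<bullet>\<^sub>H g = \<Phi> (\<lambda>s. s * \<phi> s) f \<bullet>\<^sub>H g"
proof -
  have "(\<lambda>s. clip n s * \<phi> s) = (\<lambda>s. s * \<phi> s)"
    using assms(2) clip_eq by fastforce
  then show ?thesis
    using calculus_mult[of "clip n" \<phi> f g] assms by simp
qed

lemma bounded_borel_compact_support:
  assumes "bounded_borel \<phi>" "\<And>s. \<phi> s \<noteq> 0 \<Longrightarrow> \<bar>s\<bar> \<le> real N"
  shows "bounded_borel (\<lambda>s. s * \<phi> s)"
proof -
  have "(\<lambda>s. clip N s * \<phi> s) = (\<lambda>s. s * \<phi> s)"
    using assms(2) clip_eq by fastforce
  then show ?thesis using bounded_borel_mult[OF bounded_borel_clip assms(1), of N] by simp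
qed

text \<open>For \<open>h\<close> in \<open>D\<close>, the pairing of \<open>A h\<close> with
  \<open>\<Phi> \<phi> f\<close> is the limit of the pairings of \<open>h\<close> with
  \<open>\<Phi> (clip n) (\<Phi> \<phi> f)\<close>. These are constant once \<open>n\<close> reaches
  \<open>N\<close>, because \<open>clip n\<close> is then the identity on the support of
  \<open>\<phi>\<close>. So \<open>\<Phi> \<phi> f\<close> lies in the domain of the adjoint, which
  is contained in \<open>D\<close>, and the same limit identifies its image under
  \<open>A\<close>.\<close>

lemma
  assumes \<phi>: "bounded_borel \<phi>" "\<And>s. \<phi> s \<noteq> 0 \<Longrightarrow> \<bar>s\<bar> \<le> real N" and f: "f \<in> H"
  shows compact_support_domain: "\<Phi> \<phi> f \<in> D"
    and generator_compact_support:
      "g \<in> H \<Longrightarrow> A (\<Phi> \<phi> f) \<bullet>\<^sub>H g = \<Phi> (\<lambda>s. s * \<phi> s) f \<bullet>\<^sub>H g"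
proof -
  have s\<phi>: "bounded_borel (\<lambda>s. s * \<phi> s)"
    using \<phi> by (rule bounded_borel_compact_support)
  have ev: "\<forall>\<^sub>F n in sequentially. \<Phi> (clip n) (\<Phi> \<phi> f) \<bullet>\<^sub>H g = \<Phi> (\<lambda>s. s * \<phi> s) f \<bullet>\<^sub>H g"
    if "g \<in> H" for g
    using eventually_ge_at_top[of N]
  proof eventually_elim
    case (elim n)
    have "\<bar>s\<bar> \<le> real n" if "\<phi> s \<noteq> 0" for s
      using \<phi>(2)[OF that] elim by linarith
    then show ?case using clip_calculus[of \<phi> n f g] \<phi>(1) f \<open>g \<in> H\<close> by blast
  qed
  show D: "\<Phi> \<phi> f \<in> D"
  proof (rule domainI)
    fix h assume h: "h \<in> D"
    have "(\<lambda>n. \<Phi> (clip n) h \<bullet>\<^sub>H \<Phi> \<phi> f) \<longlonglongrightarrow> A h \<bullet>\<^sub>H \<Phi> \<phi> f"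
      using h \<phi> f by (intro generator_tendsto) auto
    moreover have "\<Phi> (clip n) h \<bullet>\<^sub>H \<Phi> \<phi> f = \<Phi> (clip n) (\<Phi> \<phi> f) \<bullet>\<^sub>H h" for n
      using h \<phi> f calculus_symmetric[of "clip n" h "\<Phi> \<phi> f"]
        L2_inner_commute[of h "\<Phi> (clip n) (\<Phi> \<phi> f)"] by simp
    ultimately have "(\<lambda>n. \<Phi> (clip n) (\<Phi> \<phi> f) \<bullet>\<^sub>H h) \<longlonglongrightarrow> A h \<bullet>\<^sub>H \<Phi> \<phi> f" by simp
    moreover have "(\<lambda>n. \<Phi> (clip n) (\<Phi> \<phi> f) \<bullet>\<^sub>H h) \<longlonglongrightarrow> \<Phi> (\<lambda>s. s * \<phi> s) f \<bullet>\<^sub>H h"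
      using h by (intro tendsto_eventually ev) auto
    ultimately have "A h \<bullet>\<^sub>H \<Phi> \<phi> f = \<Phi> (\<lambda>s. s * \<phi> s) f \<bullet>\<^sub>H h"
      by (rule LIMSEQ_unique)
    then show "A h \<bullet>\<^sub>H \<Phi> \<phi> f = h \<bullet>\<^sub>H \<Phi> (\<lambda>s. s * \<phi> s) f"
      using h s\<phi> f by (simp add: L2_inner_commute)
  qed (use \<phi> s\<phi> f in auto)
  assume g: "g \<in> H"
  show "A (\<Phi> \<phi> f) \<bullet>\<^sub>H g = \<Phi> (\<lambda>s. s * \<phi> s) f \<bullet>\<^sub>H g"
    using LIMSEQ_unique[OF generator_tendsto[OF D g] tendsto_eventually[OF ev[OF g]]] .
qed

text \<open>On the spectral subspace of \<open>[-N, -1/N]\<close> the form of \<open>A\<close> is at most \<open>-1/N\<close>, which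
  contradicts nonnegativity unless the subspace is trivial.\<close>

lemma calculus_negative_axis_compact:
  assumes f: "f \<in> H"
  shows "\<Phi> (indicator {- real (Suc n) .. - inverse (real (Suc n))}) f \<bullet>\<^sub>H f \<le> 0"
proof -
  let ?\<phi> = "indicator {- real (Suc n) .. - inverse (real (Suc n))} :: real \<Rightarrow> real"
  let ?e = "inverse (real (Suc n))"
  have \<phi>: "bounded_borel ?\<phi>"
    by (auto simp: bounded_borel_def bounded_iff indicator_def intro!: exI[of _ 1])
  have supp: "\<bar>s\<bar> \<le> real (Suc n)" if "?\<phi> s \<noteq> 0" for s
  proof -
    have "- real (Suc n) \<le> s" "s \<le> - ?e"
      using that by (auto simp: indicator_def split: if_splits)
    moreover have "0 \<le> ?e" by simp
    ultimately show ?thesis by linarith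
  qed
  have s\<phi>: "bounded_borel (\<lambda>s. s * ?\<phi> s)"
    using \<phi> supp by (rule bounded_borel_compact_support)
  have idem: "(\<lambda>s. ?\<phi> s * (s * ?\<phi> s)) = (\<lambda>s. s * ?\<phi> s)"
    by (auto simp: indicator_def)
  have "0 \<le> A (\<Phi> ?\<phi> f) \<bullet>\<^sub>H \<Phi> ?\<phi> f"
    using compact_support_domain[OF \<phi> supp f] nonnegative
    by (auto simp: nonnegative_operator_def)
  also have "\<dots> = \<Phi> (\<lambda>s. s * ?\<phi> s) f \<bullet>\<^sub>H \<Phi> ?\<phi> f"
    using \<phi> f by (intro generator_compact_support[OF \<phi> supp f]) auto
  also have "\<dots> = \<Phi> (\<lambda>s. ?\<phi> s * (s * ?\<phi> s)) f \<bullet>\<^sub>H f"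
    using calculus_mult[OF \<phi> s\<phi> f f] calculus_symmetric[OF \<phi> calculus_closed[OF s\<phi> f] f]
    by (simp only:)
  also have "\<dots> = \<Phi> (\<lambda>s. s * ?\<phi> s) f \<bullet>\<^sub>H f"
    by (simp only: idem)
  finally have 1: "0 \<le> \<Phi> (\<lambda>s. s * ?\<phi> s) f \<bullet>\<^sub>H f" .
  have "\<Phi> (\<lambda>s. ?e * ?\<phi> s) f \<bullet>\<^sub>H f \<le> \<Phi> (\<lambda>s. - 1 * (s * ?\<phi> s)) f \<bullet>\<^sub>H f"
  proof (rule calculus_mono)
    show "?e * ?\<phi> s \<le> - 1 * (s * ?\<phi> s)" for s
      by (cases "s \<in> {- real (Suc n) .. - ?e}") auto
  qed (intro bounded_borel_mult bounded_borel_const \<phi> s\<phi> f)+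
  also have "\<dots> = - 1 * (\<Phi> (\<lambda>s. s * ?\<phi> s) f \<bullet>\<^sub>H f)"
    by (rule calculus_scale[OF s\<phi> f f])
  finally have "?e * (\<Phi> ?\<phi> f \<bullet>\<^sub>H f) \<le> 0"
    using 1 unfolding calculus_scale[OF \<phi> f f] by linarith
  then show ?thesis
    by (simp add: mult_le_0_iff del: of_nat_Suc)
qed

text \<open>The intervals of \<open>calculus_negative_axis_compact\<close> exhaust the open negative
  half-line, so the form of its spectral projection is 0, and the two indicators add up to 1. This
  is what makes the cut-off in \<open>heat\<close> harmless.\<close>

lemma calculus_nonnegative_axis:
  assumes f: "f \<in> H"
  shows "\<Phi> (indicator {0..}) f \<bullet>\<^sub>H f = f \<bullet>\<^sub>H f"
proof -
  have bb: "bounded_borel (indicator S)" if "S \<in> sets borel" for S :: "real set"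
    using that by (auto simp: bounded_borel_def bounded_iff indicator_def intro!: exI[of _ 1])
  have "(\<lambda>n. \<Phi> (indicator {- real (Suc n) .. - inverse (real (Suc n))}) f \<bullet>\<^sub>H f)
      \<longlonglongrightarrow> \<Phi> (indicator {..<0}) f \<bullet>\<^sub>H f"
  proof (rule calculus_tendsto[OF bb bb])
    fix s :: real
    show "(\<lambda>n. indicator {- real (Suc n) .. - inverse (real (Suc n))} s :: real)
        \<longlonglongrightarrow> indicator {..<0} s"
    proof (rule tendsto_eventually, cases "s < 0")
      case True
      have "\<forall>\<^sub>F n in sequentially. inverse (real (Suc n)) < - s"
        using True by (intro order_tendstoD[OF LIMSEQ_inverse_real_of_nat]) auto
      then show "\<forall>\<^sub>F n in sequentially.
          indicator {- real (Suc n) .. - inverse (real (Suc n))} s = (indicator {..<0} s :: real)"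
        using eventually_ge_at_top[of "nat \<lceil>- s\<rceil>"]
      proof eventually_elim
        case (elim n)
        then have "- real (Suc n) \<le> s" by linarith
        then show ?case using True elim by (auto simp: indicator_def)
      qed
    next
      case False
      then have "\<not> s \<le> - inverse (real (Suc n))" for n
        using inverse_positive_iff_positive[of "real (Suc n)"] by linarith
      then show "\<forall>\<^sub>F n in sequentially.
          indicator {- real (Suc n) .. - inverse (real (Suc n))} s = (indicator {..<0} s :: real)"
        using False by (auto simp: indicator_def)
    qed
  qed (use f in \<open>auto simp: indicator_def intro!: exI[of _ 1]\<close>)
  then have "\<Phi> (indicator {..<0}) f \<bullet>\<^sub>H f \<le> 0"
    using calculus_negative_axis_compact[OF f] by (intro LIMSEQ_le_const2) blast+
  moreover have "0 \<le> \<Phi> (indicator {..<0}) f \<bullet>\<^sub>H f"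
    using f bb by (intro calculus_nonneg) auto
  ultimately have "\<Phi> (indicator {..<0}) f \<bullet>\<^sub>H f = 0" by simp
  moreover have "(\<lambda>s :: real. indicator {0..} s + indicator {..<0} s) = (\<lambda>_. 1 :: real)"
    by (auto simp: indicator_def)
  ultimately show ?thesis
    using calculus_add[OF bb bb f f, of "{0..}" "{..<0}"] calculus_const[OF f f, of 1] by simp
qed

section \<open>The heat semigroup at small times\<close>

lemma bounded_borel_heat:
  assumes "0 \<le> t"
  shows "bounded_borel (\<lambda>s. indicator {0..} s * exp (- t * s))"
proof -
  have "\<bar>indicator {0..} s * exp (- t * s)\<bar> \<le> (1 :: real)" for s :: real
    using assms by (auto simp: indicator_def)
  then show ?thesis by (auto simp: bounded_borel_def bounded_iff)
qed

lemma heat_closed [simp]: "\<lbrakk>0 \<le> t; f \<in> H\<rbrakk> \<Longrightarrow> heat \<Phi> t f \<in> H"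
  by (simp only: heat_def calculus_closed bounded_borel_heat)

text \<open>Symmetry and the semigroup law. It rewrites the left side of the observability
  inequality as a form whose limit is given by \<open>heat_tendsto\<close>.\<close>

lemma heat_inner_self:
  assumes "0 \<le> t" "f \<in> H"
  shows "heat \<Phi> t f \<bullet>\<^sub>H heat \<Phi> t f = heat \<Phi> (2 * t) f \<bullet>\<^sub>H f"
proof -
  let ?\<phi> = "\<lambda>s. indicator {0..} s * exp (- t * s) :: real"
  have "(\<lambda>s. ?\<phi> s * ?\<phi> s) = (\<lambda>s. indicator {0..} s * exp (- (2 * t) * s))"
    by (auto simp: indicator_def simp flip: exp_add)
  then have "heat \<Phi> (2 * t) f \<bullet>\<^sub>H f = \<Phi> ?\<phi> (\<Phi> ?\<phi> f) \<bullet>\<^sub>H f"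
    using calculus_mult[of ?\<phi> ?\<phi> f f] assms bounded_borel_heat[of t] unfolding heat_def by simp
  also have "\<dots> = heat \<Phi> t f \<bullet>\<^sub>H heat \<Phi> t f"
    unfolding heat_def
    by (intro calculus_symmetric calculus_closed bounded_borel_heat assms)
  finally show ?thesis by simp
qed

text \<open>The bounded convergence clause of the calculus applies along sequences of times. The
  pointwise limit is the indicator of \<open>{0..}\<close> rather than 1, hence the appeal to
  \<open>calculus_nonnegative_axis\<close>.\<close>

lemma heat_tendsto:
  assumes f: "f \<in> H" and \<tau>: "\<And>n. 0 \<le> \<tau> n" "\<tau> \<longlonglongrightarrow> 0"
  shows "(\<lambda>n. heat \<Phi> (\<tau> n) f \<bullet>\<^sub>H f) \<longlonglongrightarrow> f \<bullet>\<^sub>H f"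
proof -
  have "(\<lambda>n. heat \<Phi> (\<tau> n) f \<bullet>\<^sub>H f) \<longlonglongrightarrow> \<Phi> (indicator {0..}) f \<bullet>\<^sub>H f"
    unfolding heat_def
  proof (rule calculus_tendsto)
    show "\<bar>indicator {0..} s * exp (- \<tau> n * s)\<bar> \<le> (1 :: real)" for n and s :: real
      using \<tau>(1)[of n] by (auto simp: indicator_def)
    show "(\<lambda>n. indicator {0..} s * exp (- \<tau> n * s)) \<longlonglongrightarrow> (indicator {0..} s :: real)" for s :: real
    proof -
      have "(\<lambda>n. indicator {0..} s * exp (- \<tau> n * s)) \<longlonglongrightarrow> (indicator {0..} s * exp (- 0 * s) :: real)"
        by (intro tendsto_intros \<tau>)
      then show ?thesis by simp
    qed
    show "bounded_borel (indicator {0..})"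
      using bounded_borel_heat[of 0] by simp
    show "bounded_borel (\<lambda>s. indicator {0..} s * exp (- \<tau> n * s))" for n
      by (rule bounded_borel_heat[OF \<tau>(1)])
  qed (use f in auto)
  then show ?thesis by (simp add: calculus_nonnegative_axis f)
qed

end

section \<open>Localised sections and their Davies--Gaffney decay\<close>

locale davies_gaffney_calculus = nonnegative_calculus B F M D A \<Phi>
  for B :: "('x::{metric_space, second_countable_topology}, 'e::topological_space) fibre_bundle"
    and F :: "'f::euclidean_space itself"
    and M :: "'x measure"
    and D :: "('x \<Rightarrow> 'e) set"
    and A :: "('x \<Rightarrow> 'e) \<Rightarrow> ('x \<Rightarrow> 'e)"
    and \<Phi> :: "(real \<Rightarrow> real) \<Rightarrow> ('x \<Rightarrow> 'e) \<Rightarrow> ('x \<Rightarrow> 'e)" +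
  assumes doubling: "doubling_metric_measure M"
    and davies_gaffney: "davies_gaffney B M \<Phi>"
begin

lemma sets_M [simp, measurable_cong]: "sets M = sets borel"
  using doubling by (simp add: doubling_metric_measure_def radon_measure_def)

lemma space_M [simp]: "space M = UNIV"
  using sets_eq_imp_space_eq[OF sets_M] by simp

lemma emeasure_ball: "0 < r \<Longrightarrow> 0 < emeasure M (ball x r)" "0 < r \<Longrightarrow> emeasure M (ball x r) < \<infinity>"
  using doubling by (auto simp: doubling_metric_measure_def)

text \<open>Balls of integer radius have finite measure and exhaust the space. This gives access to
  Fubini for controls on time times space.\<close>

sublocale sigma_finite_measure M
proof
  fix x :: 'x
  define C where "C = range (\<lambda>n. ball x (real (Suc n)))"
  have "\<Union> C = UNIV"
  proof -
    have "\<exists>n. dist x y < real (Suc n)" for y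
      using reals_Archimedean2[of "dist x y"] by (metis less_Suc_eq_le less_trans of_nat_less_iff order_refl)
    then show ?thesis by (auto simp: C_def)
  qed
  moreover have "emeasure M (ball x (real (Suc n))) \<noteq> \<infinity>" for n
    using emeasure_ball(2)[of "real (Suc n)" x] by (simp del: of_nat_Suc)
  then have "\<forall>a\<in>C. emeasure M a \<noteq> \<infinity>" by (auto simp: C_def)
  moreover have "countable C" "C \<subseteq> sets M" by (auto simp: C_def)
  ultimately show "\<exists>C. countable C \<and> C \<subseteq> sets M \<and> \<Union> C = space M \<and> (\<forall>a\<in>C. emeasure M a \<noteq> \<infinity>)"
    by (intro exI[of _ C]) auto
qed

text \<open>A constant nonzero vector \<open>b\<close> of the model fibre gives a nowhere vanishing
  section over a small ball. The fibre metric is merely Borel, so its norm may be unbounded there;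
  restricting to a sublevel set of positive measure, extending by zero and normalising yields the
  section.\<close>

lemma localized_section:
  assumes "0 < \<delta>"
  obtains E f where "E \<in> sets M" "E \<noteq> {}" "E \<subseteq> ball x \<delta>" "f \<in> H" "f \<bullet>\<^sub>H f = 1" "cutoff B E f = f"
proof -
  obtain U \<tau> \<sigma> where U: "open U" "x \<in> U"
    "homeomorphism (proj B -` U) (U \<times> (UNIV :: 'f set)) \<tau> \<sigma>"
    "\<And>v. v \<in> proj B -` U \<Longrightarrow> fst (\<tau> v) = proj B v"
    "\<And>a v. v \<in> proj B -` U \<Longrightarrow> snd (\<tau> (fscale B a v)) = a *\<^sub>R snd (\<tau> v)"
    by (rule local_trivialisation[of x]) blast
  obtain \<rho> where \<rho>: "0 < \<rho>" "\<rho> \<le> \<delta>" "ball x \<rho> \<subseteq> U"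
  proof -
    obtain e where "0 < e" "ball x e \<subseteq> U"
      using U(1,2) open_contains_ball by blast
    then show ?thesis using that[of "min e \<delta>"] assms by (auto simp: subset_eq)
  qed
  obtain b :: 'f where b: "b \<in> Basis" using nonempty_Basis by blast
  define s where "s y = \<sigma> (y, b)" for y
  define V where "V = ball x \<rho>"
  have VU: "V \<subseteq> U" and V: "V \<in> sets M" using \<rho> by (auto simp: V_def)
  have \<tau>s: "\<tau> (s y) = (y, b)" if "y \<in> U" for y
    using that homeomorphism_apply2[OF U(3)] by (simp add: s_def)
  have sU: "s y \<in> proj B -` U" if "y \<in> U" for y
    using that homeomorphism_image2[OF U(3)] unfolding s_def by blast
  have proj_s: "proj B (s y) = y" if "y \<in> U" for y
    using U(4)[OF sU[OF that]] \<tau>s[OF that] by simp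
  have s_nz: "0 < finner B (s y) (s y)" if "y \<in> U" for y
  proof (rule finner_pos)
    show "s y \<noteq> fscale B 0 (s y)"
      using U(5)[OF sU[OF that], of 0] \<tau>s[OF that] b by auto
  qed
  have s_cont: "continuous_on V s"
    unfolding s_def using VU
    by (intro continuous_on_compose2[OF homeomorphism_cont2[OF U(3)]] continuous_intros) auto
  obtain s0 where s0: "s0 \<in> H" using L2_nonempty by blast
  \<comment> \<open>The zero section; it is measurable because it is a multiple of an element of
    \<open>H\<close>.\<close>
  define z where "z = sec_scale B 0 s0"
  have z: "z \<in> H" using s0 by (simp add: z_def L2_scale)
  have zz: "fscale B a (z y) = z y" for a y
    by (simp add: z_def sec_scale_def)
  have finner_z: "finner B (z y) (z y) = 0" for y
    using finner_fscale_left[of "z y" "z y" 0] by (simp add: zz)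
  have s_meas: "s \<in> borel_measurable (restrict_space M V)"
    using borel_measurable_continuous_on_restrict[OF s_cont]
    by (subst measurable_cong_sets[OF sets_restrict_space_cong[OF sets_M] refl])
  \<comment> \<open>Measurability into the Borel sets of the product space comes from continuity of
    the pair map, since these sets may exceed the product \<sigma>-algebra.\<close>
  have "(\<lambda>y. (s y, s y)) \<in> borel_measurable (restrict_space M V)"
    using borel_measurable_continuous_on_restrict[OF continuous_on_Pair[OF s_cont s_cont]]
    by (subst measurable_cong_sets[OF sets_restrict_space_cong[OF sets_M] refl])
  then have "(\<lambda>y. (s y, s y)) \<in> measurable (restrict_space M V)
      (restrict_space borel {(u, v). proj B u = proj B v})"
    by (intro measurable_restrict_space2) auto
  from measurable_compose[OF this finner_measurable]
  have "(\<lambda>y. finner B (s y) (s y)) \<in> borel_measurable (restrict_space M V)" by simp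
  then have N: "(\<lambda>y. if y \<in> V then finner B (s y) (s y) else 0) \<in> borel_measurable M"
    (is "?N \<in> _")
    using V by (subst measurable_If_restrict_space_iff) auto
  have z_meas: "z \<in> borel_measurable M" using z by (rule L2_measurable)
  have g: "(\<lambda>y. if y \<in> V then s y else z y) \<in> borel_measurable M"
    using V s_meas measurable_restrict_space1[OF z_meas]
    by (subst measurable_If_restrict_space_iff) auto
  \<comment> \<open>These sets increase to \<open>V\<close>, which has positive measure, so one of
    them is not null.\<close>
  define E where "E n = {y \<in> V. ?N y \<le> real n}" for n
  have E: "E n \<in> sets M" for n
  proof -
    have "{y \<in> space M. ?N y \<le> real n} \<in> sets M" by (rule borel_measurable_le[OF N]) simp
    moreover have "E n = V \<inter> {y \<in> space M. ?N y \<le> real n}" by (auto simp: E_def)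
    ultimately show ?thesis using V by (simp only: sets.Int)
  qed
  obtain n where n: "emeasure M (E n) \<noteq> 0"
  proof (rule ccontr)
    assume "\<not> thesis"
    then have "E n \<in> null_sets M" for n using that[of n] E[of n] by (auto simp: null_sets_def)
    then have "(\<Union>n. E n) \<in> null_sets M" by (intro null_sets_UN)
    moreover have "(\<Union>n. E n) = V"
      using real_arch_simple by (auto simp: E_def)
    ultimately show False using emeasure_ball(1)[OF \<rho>(1), of x] by (auto simp: V_def)
  qed
  have EV: "E n \<subseteq> V" by (auto simp: E_def)
  define f where "f y = (if y \<in> E n then s y else z y)" for y
  have "f = (\<lambda>y. if y \<in> E n then (if y \<in> V then s y else z y) else z y)"
    using EV by (auto simp: f_def fun_eq_iff)
  moreover have "(\<lambda>y. if y \<in> E n then (if y \<in> V then s y else z y) else z y) \<in> borel_measurable M"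
    by (rule measurable_If_set[OF g z_meas]) (simp add: E[simplified])
  ultimately have "f \<in> borel_measurable M" by simp
  moreover have "proj B (f y) = y" for y
    using L2_proj[OF z, of y] proj_s[of y] EV VU by (auto simp: f_def)
  ultimately have f_sec: "f \<in> borel_sections B M"
    by (simp add: borel_sections_def)
  have ff: "finner B (f y) (f y) = indicator (E n) y * ?N y" for y
    using EV by (auto simp: f_def finner_z)
  have "emeasure M (E n) \<le> emeasure M V" using EV V by (intro emeasure_mono)
  then have finite: "emeasure M (E n) < \<infinity>"
    using emeasure_ball(2)[OF \<rho>(1), of x] by (simp add: V_def order.strict_trans1)
  have "integrable M (\<lambda>y. indicator (E n) y * ?N y)"
  proof (rule Bochner_Integration.integrable_bound)
    show "integrable M (\<lambda>y. indicator (E n) y * real n)"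
      by (intro integrable_mult_left integrable_real_indicator E finite)
    show "AE y in M. norm (indicator (E n) y * ?N y) \<le> norm (indicator (E n) y * real n)"
      by (auto simp: indicator_def E_def)
  qed (use N E in simp)
  then have f: "f \<in> H" unfolding L2_def using f_sec by (simp add: ff)
  have "f \<bullet>\<^sub>H f \<noteq> 0"
  proof
    assume "f \<bullet>\<^sub>H f = 0"
    then have "AE y in M. finner B (f y) (f y) = 0"
      using integral_nonneg_eq_0_iff_AE[OF L2_integrable_self[OF f]] by (simp add: L2_inner_def)
    then have "AE y in M. y \<notin> E n"
    proof eventually_elim
      case (elim y)
      then show ?case using EV VU s_nz[of y] by (auto simp: f_def split: if_splits)
    qed
    then show False using n by (simp add: AE_iff_measurable[OF E])
  qed
  then have pos: "0 < f \<bullet>\<^sub>H f" using L2_inner_nonneg[of f] by linarith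
  define c where "c = inverse (sqrt (f \<bullet>\<^sub>H f))"
  show thesis
  proof (rule that)
    show "E n \<noteq> {}" using n by auto
    show "E n \<subseteq> ball x \<delta>" using EV \<rho> by (auto simp: V_def)
    have "c * (c * (f \<bullet>\<^sub>H f)) = 1"
      using pos by (simp add: c_def field_simps)
    then show "sec_scale B c f \<bullet>\<^sub>H sec_scale B c f = 1"
      using f by (simp add: L2_inner_scale_left L2_inner_scale_right L2_scale)
    show "cutoff B (E n) (sec_scale B c f) = sec_scale B c f"
      using zz by (auto simp: cutoff_def sec_scale_def f_def fun_eq_iff indicator_def)
  qed (use f E[of n] in \<open>auto simp: L2_scale\<close>)
qed

text \<open>Removing \<open>ball x r\<close> from \<open>\<omega>\<close> changes it by a null set
  and leaves a set at distance at least \<open>d\<close> from \<open>ball x (r - d)\<close>, where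
  \<open>f\<close> is supported. Squaring the Davies--Gaffney bound turns \<open>4 * t\<close> into
  \<open>2 * t\<close>.\<close>

lemma localized_section_decay:
  assumes \<omega>: "\<omega> \<in> sets M" "0 < emeasure M \<omega>" "emeasure M (ball x r \<inter> \<omega>) = 0"
    and d: "0 < d" "d < r"
  obtains f where "f \<in> H" "f \<bullet>\<^sub>H f = 1"
    "\<And>t. 0 < t \<Longrightarrow> cutoff B \<omega> (heat \<Phi> t f) \<bullet>\<^sub>H cutoff B \<omega> (heat \<Phi> t f) \<le> exp (- d\<^sup>2 / (2 * t))"
proof -
  obtain E f where E: "E \<in> sets M" "E \<noteq> {}" "E \<subseteq> ball x (r - d)"
    and f: "f \<in> H" "f \<bullet>\<^sub>H f = 1" "cutoff B E f = f"
    using localized_section[of "r - d" x] d by auto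
  define S where "S = \<omega> - ball x r"
  have S: "S \<in> sets M" using \<omega> by (auto simp: S_def)
  \<comment> \<open>\<open>setdist\<close> is 0 when one of its arguments is empty, so a lower bound
    on it requires a point of \<open>S\<close>; here the positive measure of \<open>\<omega>\<close>
    enters.\<close>
  have "S \<noteq> {}"
  proof
    assume "S = {}"
    then have "ball x r \<inter> \<omega> = \<omega>" by (auto simp: S_def)
    then show False using \<omega> by simp
  qed
  have "d \<le> setdist E S"
  proof (rule le_setdistI)
    fix y w assume "y \<in> E" "w \<in> S"
    then have "dist x y < r - d" "r \<le> dist x w" using E by (auto simp: S_def)
    then show "d \<le> dist y w" using dist_triangle[of x w y] by linarith
  qed (use E \<open>S \<noteq> {}\<close> in auto)
  then have dist: "d\<^sup>2 \<le> (setdist E S)\<^sup>2" using d by (intro power_mono) auto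
  have "cutoff B \<omega> (heat \<Phi> t f) \<bullet>\<^sub>H cutoff B \<omega> (heat \<Phi> t f) \<le> exp (- d\<^sup>2 / (2 * t))"
    if t: "0 < t" for t
  proof -
    let ?v = "heat \<Phi> t f"
    have v: "?v \<in> H" using f t by simp
    have "(ball x r \<inter> \<omega>) \<in> null_sets M" using \<omega> by auto
    then have "AE y in M. y \<notin> ball x r \<inter> \<omega>" by (rule AE_not_in)
    then have AE: "AE y in M. indicator \<omega> y * finner B (?v y) (?v y)
        = indicator S y * finner B (?v y) (?v y)"
      by eventually_elim (auto simp: S_def indicator_def)
    have [measurable]: "(\<lambda>y. finner B (?v y) (?v y)) \<in> borel_measurable M" "\<omega> \<in> sets M" "S \<in> sets M"
      using L2_integrable_self[OF v] \<omega> S by (auto intro: borel_measurable_integrable)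
    have eq: "cutoff B \<omega> ?v \<bullet>\<^sub>H cutoff B \<omega> ?v = cutoff B S ?v \<bullet>\<^sub>H cutoff B S ?v"
      unfolding L2_inner_cutoff using AE by (intro integral_cong_AE) measurable
    \<comment> \<open>The supremum in the operator norm is tested at \<open>f\<close>, which has
      norm 1 and is fixed by the cut-off to \<open>E\<close>.\<close>
    have "ereal (L2_norm B M (cutoff B S ?v))
        \<le> op_norm_L2 B M (\<lambda>g. ereal (L2_norm B M g)) (\<lambda>f. cutoff B S (heat \<Phi> t (cutoff B E f)))"
      unfolding op_norm_L2_def by (rule SUP_upper2[of f]) (use f in \<open>auto simp: L2_norm_def\<close>)
    also have "\<dots> \<le> ereal (exp (- (setdist E S)\<^sup>2 / (4 * t)))"
      using davies_gaffney E S t unfolding davies_gaffney_def by blast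
    also have "\<dots> \<le> ereal (exp (- d\<^sup>2 / (4 * t)))"
      using dist t by (simp add: divide_right_mono)
    finally have "(L2_norm B M (cutoff B S ?v))\<^sup>2 \<le> (exp (- d\<^sup>2 / (4 * t)))\<^sup>2"
      by (intro power_mono) auto
    also have "\<dots> = exp (- d\<^sup>2 / (2 * t))"
      by (simp add: power2_eq_square field_simps flip: exp_add)
    finally show ?thesis by (simp add: L2_norm_power2 eq)
  qed
  with f that show thesis by blast
qed

section \<open>Bounds at a fixed time and their small-time consequences\<close>

lemma exp_decay_mono:
  "\<lbrakk>0 < t; t \<le> T\<rbrakk> \<Longrightarrow> exp (- d\<^sup>2 / (2 * t)) \<le> exp (- d\<^sup>2 / (2 * T))" for d :: real
  by (simp add: divide_left_mono)

text \<open>The decay bound increases with time, so its value at \<open>T\<close> dominates the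
  integrand on the whole interval; the factor \<open>T\<close> is the length of that
  interval.\<close>

lemma observability_lower_bound:
  assumes f: "f \<in> H"
    and decay: "\<And>t. 0 < t \<Longrightarrow>
      cutoff B \<omega> (heat \<Phi> t f) \<bullet>\<^sub>H cutoff B \<omega> (heat \<Phi> t f) \<le> exp (- d\<^sup>2 / (2 * t))"
    and obs: "observability B M \<Phi> \<omega> T c" "0 \<le> c" "0 < T"
  shows "heat \<Phi> (2 * T) f \<bullet>\<^sub>H f \<le> c * (T * exp (- d\<^sup>2 / (2 * T)))"
proof -
  let ?I = "LINT t:{0<..<T}|lborel. (L2_norm B M (cutoff B \<omega> (heat \<Phi> t f)))\<^sup>2"
  have "\<bar>?I\<bar> \<le> (\<integral>t. indicator {0<..<T} t * exp (- d\<^sup>2 / (2 * T)) \<partial>lborel)"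
    unfolding set_lebesgue_integral_def
  proof (rule abs_integral_le_of_AE_bound)
    show "AE t in lborel. \<bar>indicat_real {0<..<T} t *\<^sub>R (L2_norm B M (cutoff B \<omega> (heat \<Phi> t f)))\<^sup>2\<bar>
        \<le> indicator {0<..<T} t * exp (- d\<^sup>2 / (2 * T))"
    proof (rule AE_I2)
      fix t
      have "(L2_norm B M (cutoff B \<omega> (heat \<Phi> t f)))\<^sup>2 \<le> exp (- d\<^sup>2 / (2 * T))" if "0 < t" "t < T"
        unfolding L2_norm_power2 using that by (intro order_trans[OF decay exp_decay_mono]) auto
      then show "\<bar>indicat_real {0<..<T} t *\<^sub>R (L2_norm B M (cutoff B \<omega> (heat \<Phi> t f)))\<^sup>2\<bar>
        \<le> indicator {0<..<T} t * exp (- d\<^sup>2 / (2 * T))"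
        by (auto simp: indicator_def)
    qed
  qed (use obs in simp)
  also have "\<dots> = T * exp (- d\<^sup>2 / (2 * T))" using obs by simp
  finally have "?I \<le> T * exp (- d\<^sup>2 / (2 * T))" by simp
  then have "c * ?I \<le> c * (T * exp (- d\<^sup>2 / (2 * T)))"
    using obs by (intro mult_left_mono)
  moreover have "heat \<Phi> (2 * T) f \<bullet>\<^sub>H f \<le> c * ?I"
    using bspec[OF obs(1)[unfolded observability_def] f]
      heat_inner_self[OF less_imp_le[OF obs(3)] f]
    unfolding L2_norm_power2 by linarith
  ultimately show ?thesis by linarith
qed

text \<open>\<open>abs_finner_le\<close> integrated over \<open>M\<close>. Since \<open>u\<close> is
  only assumed to be a section with integrable squared norm, the estimate is pointwise instead of
  passing through \<open>L2_Cauchy_Schwarz\<close>; it is linear in the energy of \<open>u\<close>,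
  hence ready to be integrated in time.\<close>

lemma control_pairing_bound:
  assumes u: "\<And>x. proj B (u x) = x" "integrable M (\<lambda>x. finner B (u x) (u x))"
    and v: "v \<in> H" and \<omega>: "\<omega> \<in> sets M" and a: "0 < a"
  shows "\<bar>cutoff B \<omega> u \<bullet>\<^sub>H v\<bar>
    \<le> (a * (\<integral>x. finner B (u x) (u x) \<partial>M) + (cutoff B \<omega> v \<bullet>\<^sub>H cutoff B \<omega> v) / a) / 2"
proof -
  have i: "integrable M (\<lambda>x. indicator \<omega> x * finner B (v x) (v x))"
    using integrable_mult_indicator[OF \<omega> L2_integrable_self[OF v]] by simp
  have "\<bar>cutoff B \<omega> u \<bullet>\<^sub>H v\<bar>
      \<le> (\<integral>x. (a * finner B (u x) (u x) + indicator \<omega> x * finner B (v x) (v x) / a) / 2 \<partial>M)"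
    unfolding L2_inner_def
  proof (rule abs_integral_le_of_AE_bound)
    show "integrable M (\<lambda>x. (a * finner B (u x) (u x) + indicator \<omega> x * finner B (v x) (v x) / a) / 2)"
      using u i by (intro integrable_divide integrable_mult_right Bochner_Integration.integrable_add)
    show "AE x in M. \<bar>finner B (cutoff B \<omega> u x) (v x)\<bar>
        \<le> (a * finner B (u x) (u x) + indicator \<omega> x * finner B (v x) (v x) / a) / 2"
    proof (rule AE_I2)
      fix x
      have "\<bar>finner B (u x) (v x)\<bar> \<le> (a * finner B (u x) (u x) + finner B (v x) (v x) / a) / 2"
        using u v a by (intro abs_finner_le) auto
      then show "\<bar>finner B (cutoff B \<omega> u x) (v x)\<bar>
        \<le> (a * finner B (u x) (u x) + indicator \<omega> x * finner B (v x) (v x) / a) / 2"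
        using u v a by (auto simp: finner_cutoff_left indicator_def)
    qed
  qed
  also have "\<dots> = (a * (\<integral>x. finner B (u x) (u x) \<partial>M) + (cutoff B \<omega> v \<bullet>\<^sub>H cutoff B \<omega> v) / a) / 2"
    using u i by (simp add: L2_inner_cutoff)
  finally show ?thesis .
qed

text \<open>The Duhamel formula at time \<open>T\<close>, tested against \<open>f\<close>, makes the
  control term cancel the heat term. The constant \<open>c\<close> is kept apart from the cost
  \<open>c'\<close>, which may be 0, because the weight \<open>a\<close> divides by it.\<close>

lemma null_control_lower_bound:
  assumes f: "f \<in> H" "f \<bullet>\<^sub>H f = 1"
    and decay: "\<And>t. 0 < t \<Longrightarrow>
      cutoff B \<omega> (heat \<Phi> t f) \<bullet>\<^sub>H cutoff B \<omega> (heat \<Phi> t f) \<le> exp (- d\<^sup>2 / (2 * t))"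
    and \<omega>: "\<omega> \<in> sets M"
    and nc: "null_controllable_with_cost B M \<Phi> \<omega> T c'" "c' \<le> c" "0 < c" "0 < T"
  shows "heat \<Phi> T f \<bullet>\<^sub>H f \<le> sqrt T * exp (- d\<^sup>2 / (4 * T)) * c"
proof -
  obtain u y where u: "u \<in> controls B M T" and y: "mild_solution B M \<Phi> \<omega> T f u y"
    and yT: "L2_norm B M (y T) = 0" and cost: "control_norm B M T u \<le> c' * L2_norm B M f"
    using bspec[OF nc(1)[unfolded null_controllable_with_cost_def] f(1)] by blast
  define R where "R = restrict_space lborel {0<..<T}"
  define q where "q = exp (- d\<^sup>2 / (4 * T))"
  \<comment> \<open>the weight that balances the two terms of \<open>control_pairing_bound\<close>\<close>
  define a where "a = sqrt T * q / c"
  define N where "N s = (\<integral>x. finner B (u s x) (u s x) \<partial>M)" for s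
  have a: "0 < a" and q: "0 < q" using nc by (auto simp: a_def q_def)
  have q2: "exp (- d\<^sup>2 / (2 * T)) = q\<^sup>2"
    by (simp add: q_def power2_eq_square field_simps flip: exp_add)
  have space_R: "space R = {0<..<T}" by (simp add: R_def space_restrict_space)
  have R_space: "emeasure R {0<..<T} = ennreal T"
    using nc by (simp add: R_def emeasure_restrict_space)
  \<comment> \<open>Finiteness makes the constant \<open>q\<^sup>2 / a\<close> integrable in time
    and supplies the \<sigma>-finiteness for Fubini.\<close>
  interpret R: finite_measure R
    by (rule finite_measureI) (simp add: space_R R_space)
  interpret RM: pair_sigma_finite R M ..
  have int_u: "integrable (R \<Otimes>\<^sub>M M) (\<lambda>(s, x). finner B (u s x) (u s x))"
    and proj_u: "\<And>s x. proj B (u s x) = x"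
    using u by (auto simp: controls_def control_measure_def R_def)
  have "integrable R N" unfolding N_def by (rule RM.integrable_fst[OF int_u])
  have "control_norm B M T u = sqrt (\<integral>s. N s \<partial>R)"
    using RM.integral_fst[OF int_u] by (simp add: control_norm_def control_measure_def R_def N_def)
  moreover have "L2_norm B M f = 1" by (simp add: L2_norm_def f)
  ultimately have "sqrt (\<integral>s. N s \<partial>R) \<le> c" using cost nc by simp
  then have N_le: "(\<integral>s. N s \<partial>R) \<le> c\<^sup>2" using nc by (simp add: sqrt_le_D)
  let ?G = "\<lambda>s. cutoff B \<omega> (u s) \<bullet>\<^sub>H heat \<Phi> (T - s) f"
  have "y T \<bullet>\<^sub>H f = heat \<Phi> T f \<bullet>\<^sub>H f + (LINT s:{0<..<T}|lborel. ?G s)"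
    and "y T \<in> H"
    using y f nc by (auto simp: mild_solution_def)
  \<comment> \<open>The final state has norm 0, which gives vanishing only almost everywhere;
    Cauchy--Schwarz is enough for the pairing.\<close>
  moreover from L2_Cauchy_Schwarz[OF \<open>y T \<in> H\<close> f(1)] have "y T \<bullet>\<^sub>H f = 0" by (simp add: yT)
  moreover have "(LINT s:{0<..<T}|lborel. ?G s) = (\<integral>s. ?G s \<partial>R)"
    by (simp add: set_lebesgue_integral_def R_def integral_restrict_space)
  ultimately have "heat \<Phi> T f \<bullet>\<^sub>H f \<le> \<bar>\<integral>s. ?G s \<partial>R\<bar>" by linarith
  also have "\<dots> \<le> (\<integral>s. (a * N s + q\<^sup>2 / a) / 2 \<partial>R)"
  proof (rule abs_integral_le_of_AE_bound)
    show "integrable R (\<lambda>s. (a * N s + q\<^sup>2 / a) / 2)"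
      using \<open>integrable R N\<close> by simp
    \<comment> \<open>Fubini makes only almost every time slice of the control square integrable, so
      the bound on \<open>?G\<close> is claimed almost everywhere.\<close>
    have "AE s in R. integrable M (\<lambda>x. finner B (u s x) (u s x))"
      by (rule RM.AE_integrable_fst[OF int_u])
    moreover have "AE s in R. s \<in> {0<..<T}" using AE_space[of R] by (simp add: space_R)
    ultimately show "AE s in R. \<bar>?G s\<bar> \<le> (a * N s + q\<^sup>2 / a) / 2"
    proof eventually_elim
      case (elim s)
      let ?v = "heat \<Phi> (T - s) f"
      have "\<bar>?G s\<bar> \<le> (a * N s + (cutoff B \<omega> ?v \<bullet>\<^sub>H cutoff B \<omega> ?v) / a) / 2"
        unfolding N_def using elim f \<omega> a proj_u by (intro control_pairing_bound) auto
      moreover have "cutoff B \<omega> ?v \<bullet>\<^sub>H cutoff B \<omega> ?v \<le> q\<^sup>2"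
        unfolding q2[symmetric] using elim by (intro order_trans[OF decay exp_decay_mono]) auto
      then have "(cutoff B \<omega> ?v \<bullet>\<^sub>H cutoff B \<omega> ?v) / a \<le> q\<^sup>2 / a"
        using a by (intro divide_right_mono) auto
      ultimately show ?case by simp
    qed
  qed
  also have "\<dots> = (a * (\<integral>s. N s \<partial>R) + T * (q\<^sup>2 / a)) / 2"
  proof -
    have "measure R (space R) = T"
      using nc by (simp add: space_R measure_def R_space)
    then show ?thesis using \<open>integrable R N\<close> by simp
  qed
  also have "\<dots> \<le> (a * c\<^sup>2 + T * (q\<^sup>2 / a)) / 2"
    using N_le a by simp
  also have "\<dots> = sqrt T * q * c"
  proof -
    have "T * (q\<^sup>2 / a) = sqrt T * q * c"
      using nc q real_sqrt_mult_self[of T] by (simp add: a_def power2_eq_square field_simps)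
    moreover have "a * c\<^sup>2 = sqrt T * q * c"
      using nc by (simp add: a_def power2_eq_square)
    ultimately show ?thesis by simp
  qed
  finally show ?thesis by (simp add: q_def)
qed

text \<open>Along \<open>T0 / (n + 1)\<close> the left side tends to 1 and the bound to 0. The
  factor \<open>k\<close> is 2 for observability, where a squared norm doubles the time, and 1 for
  control.\<close>

lemma heat_not_vanishing:
  assumes f: "f \<in> H" "f \<bullet>\<^sub>H f = 1" and "0 < T0" "0 \<le> k"
    and le: "\<And>T. \<lbrakk>0 < T; T \<le> T0\<rbrakk> \<Longrightarrow> heat \<Phi> (k * T) f \<bullet>\<^sub>H f \<le> g T"
    and g: "(g \<longlongrightarrow> 0) (at_right 0)"
  shows False
proof -
  define \<tau> where "\<tau> n = T0 * inverse (real (Suc n))" for n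
  have pos: "0 < \<tau> n" "\<tau> n \<le> T0" for n
    using \<open>0 < T0\<close> by (auto simp: \<tau>_def field_simps)
  have lim: "\<tau> \<longlonglongrightarrow> 0"
    unfolding \<tau>_def using LIMSEQ_inverse_real_of_nat by (rule tendsto_mult_right_zero)
  have "(\<lambda>n. heat \<Phi> (k * \<tau> n) f \<bullet>\<^sub>H f) \<longlonglongrightarrow> 1"
    using heat_tendsto[of f "\<lambda>n. k * \<tau> n"] f \<open>0 \<le> k\<close> less_imp_le[OF pos(1)]
      tendsto_mult_right_zero[OF lim]
    by simp
  moreover have "filterlim \<tau> (at_right 0) sequentially"
    using lim by (simp add: filterlim_at pos less_imp_neq[OF pos(1), symmetric])
  then have "(\<lambda>n. g (\<tau> n)) \<longlonglongrightarrow> 0" by (rule filterlim_compose[OF g])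
  ultimately have "(1 :: real) \<le> 0"
    by (rule LIMSEQ_le) (use le pos in auto)
  then show False by simp
qed

text \<open>If \<open>d\<^sup>2\<close> exceeded \<open>2 * K\<close>, the two exponentials would
  multiply to at most 1, and the remaining factor \<open>C * T\<close> tends to 0.\<close>

lemma observability_decay_bound:
  assumes f: "f \<in> H" "f \<bullet>\<^sub>H f = 1"
    and decay: "\<And>t. 0 < t \<Longrightarrow>
      cutoff B \<omega> (heat \<Phi> t f) \<bullet>\<^sub>H cutoff B \<omega> (heat \<Phi> t f) \<le> exp (- d\<^sup>2 / (2 * t))"
    and obs: "0 < T0" "0 < C" "\<And>T. \<lbrakk>0 < T; T \<le> T0\<rbrakk> \<Longrightarrow> observability B M \<Phi> \<omega> T (C * exp (K / T))"
  shows "d\<^sup>2 \<le> 2 * K"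
proof (rule ccontr)
  assume K: "\<not> d\<^sup>2 \<le> 2 * K"
  have "heat \<Phi> (2 * T) f \<bullet>\<^sub>H f \<le> C * T" if T: "0 < T" "T \<le> T0" for T
  proof -
    have "heat \<Phi> (2 * T) f \<bullet>\<^sub>H f \<le> C * exp (K / T) * (T * exp (- d\<^sup>2 / (2 * T)))"
      using obs T by (intro observability_lower_bound[OF f(1) decay]) auto
    also have "\<dots> = C * T * (exp (K / T) * exp (- d\<^sup>2 / (2 * T)))"
      by (simp only: ac_simps)
    also have "exp (K / T) * exp (- d\<^sup>2 / (2 * T)) = exp ((2 * K - d\<^sup>2) / (2 * T))"
      unfolding exp_add[symmetric] using T by (simp add: field_simps)
    also have "C * T * exp ((2 * K - d\<^sup>2) / (2 * T)) \<le> C * T * 1"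
      using K T obs(2) by (intro mult_left_mono) (auto simp: divide_nonpos_pos)
    finally show ?thesis by simp
  qed
  moreover have "((\<lambda>T. C * T) \<longlongrightarrow> 0) (at_right 0)"
    by (rule tendsto_mult_right_zero) (rule tendsto_ident_at)
  ultimately show False by (intro heat_not_vanishing[OF f obs(1), of 2]) auto
qed

text \<open>As for observability, with \<open>sqrt T\<close> as the vanishing factor. The constant
  is 4 because the cost bounds the norm of the control and not its square.\<close>

lemma control_cost_decay_bound:
  assumes f: "f \<in> H" "f \<bullet>\<^sub>H f = 1"
    and decay: "\<And>t. 0 < t \<Longrightarrow>
      cutoff B \<omega> (heat \<Phi> t f) \<bullet>\<^sub>H cutoff B \<omega> (heat \<Phi> t f) \<le> exp (- d\<^sup>2 / (2 * t))"
    and \<omega>: "\<omega> \<in> sets M"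
    and cost: "0 < T0" "0 < C"
      "\<And>T. \<lbrakk>0 < T; T \<le> T0\<rbrakk> \<Longrightarrow> control_cost B M \<Phi> \<omega> T \<le> ennreal (C * exp (K / T))"
  shows "d\<^sup>2 \<le> 4 * K"
proof (rule ccontr)
  assume K: "\<not> d\<^sup>2 \<le> 4 * K"
  have "heat \<Phi> (1 * T) f \<bullet>\<^sub>H f \<le> 2 * C * sqrt T" if T: "0 < T" "T \<le> T0" for T
  proof -
    \<comment> \<open>The cost is an infimum that need not be attained; doubling its bound gives a
      strict inequality and hence an admissible constant below \<open>c\<close>.\<close>
    define c where "c = 2 * (C * exp (K / T))"
    have "0 < C * exp (K / T)" using cost(2) by simp
    then have "0 < c" and "C * exp (K / T) < c" unfolding c_def by linarith+
    then have "control_cost B M \<Phi> \<omega> T < ennreal c"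
      using cost(3)[OF T] cost(2) by (elim order.strict_trans1) (simp add: ennreal_less_iff)
    then obtain c' where "null_controllable_with_cost B M \<Phi> \<omega> T c'" "0 \<le> c'" "ennreal c' < ennreal c"
      unfolding control_cost_def INF_less_iff by blast
    then have "heat \<Phi> T f \<bullet>\<^sub>H f \<le> sqrt T * exp (- d\<^sup>2 / (4 * T)) * c"
      using T \<open>0 < c\<close> by (intro null_control_lower_bound[OF f decay \<omega>]) (auto simp: ennreal_less_iff)
    also have "\<dots> = 2 * C * sqrt T * (exp (K / T) * exp (- d\<^sup>2 / (4 * T)))"
      by (simp only: c_def ac_simps)
    also have "exp (K / T) * exp (- d\<^sup>2 / (4 * T)) = exp ((4 * K - d\<^sup>2) / (4 * T))"
      unfolding exp_add[symmetric] using T by (simp add: field_simps)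
    also have "2 * C * sqrt T * exp ((4 * K - d\<^sup>2) / (4 * T)) \<le> 2 * C * sqrt T * 1"
      using K T cost(2) by (intro mult_left_mono) (auto simp: divide_nonpos_pos)
    finally show ?thesis by simp
  qed
  moreover have "((\<lambda>T. 2 * C * sqrt T) \<longlongrightarrow> 0) (at_right 0)"
  proof -
    have "((\<lambda>T. 2 * C * sqrt T) \<longlongrightarrow> 2 * C * sqrt 0) (at_right 0)" by (intro tendsto_intros)
    then show ?thesis by simp
  qed
  ultimately show False by (intro heat_not_vanishing[OF f cost(1), of 1]) auto
qed

text \<open>Every \<open>d\<close> below an admissible radius \<open>r\<close> comes with a decaying
  section, so \<open>bound\<close> gives \<open>d \<le> sqrt b\<close>, and density of the reals
  carries this to \<open>r\<close>. Both conclusions of the theorem follow, with \<open>b\<close>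
  equal to \<open>2 * K\<close> and \<open>4 * K\<close>.\<close>

lemma max_ess_dist_power2_le:
  assumes \<omega>: "\<omega> \<in> sets M" "0 < emeasure M \<omega>" and b: "0 \<le> b"
    and bound: "\<And>f d. \<lbrakk>f \<in> H; f \<bullet>\<^sub>H f = 1;
      \<And>t. 0 < t \<Longrightarrow>
        cutoff B \<omega> (heat \<Phi> t f) \<bullet>\<^sub>H cutoff B \<omega> (heat \<Phi> t f) \<le> exp (- d\<^sup>2 / (2 * t))\<rbrakk> \<Longrightarrow> d\<^sup>2 \<le> b"
  shows "(max_ess_dist M \<omega>)\<^sup>2 \<le> ennreal b"
proof -
  have "r \<le> sqrt b" if r: "0 < r" "emeasure M (ball x r \<inter> \<omega>) = 0" for x r
  proof (rule dense_le_bounded[OF r(1)])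
    fix d assume d: "0 < d" "d < r"
    obtain f where "f \<in> H" "f \<bullet>\<^sub>H f = 1" "\<And>t. 0 < t \<Longrightarrow>
        cutoff B \<omega> (heat \<Phi> t f) \<bullet>\<^sub>H cutoff B \<omega> (heat \<Phi> t f) \<le> exp (- d\<^sup>2 / (2 * t))"
      by (rule localized_section_decay[OF \<omega> r(2) d]) blast
    then show "d \<le> sqrt b" by (intro real_le_rsqrt bound)
  qed
  then have "max_ess_dist M \<omega> \<le> ennreal (sqrt b)"
    unfolding max_ess_dist_def ess_dist_def by (intro SUP_least ennreal_leI) auto
  then have "(max_ess_dist M \<omega>)\<^sup>2 \<le> ennreal (sqrt b) * ennreal (sqrt b)"
    unfolding power2_eq_square by (intro mult_mono) auto
  also have "\<dots> = ennreal b" using b by (simp flip: ennreal_mult)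
  finally show ?thesis .
qed

end

theorem corollary2:
  fixes M :: "'x::{metric_space, second_countable_topology} measure"
    and B :: "('x, 'e::topological_space) fibre_bundle"
    and D :: "('x \<Rightarrow> 'e) set"
    and A :: "('x \<Rightarrow> 'e) \<Rightarrow> ('x \<Rightarrow> 'e)"
    and \<Phi> :: "(real \<Rightarrow> real) \<Rightarrow> ('x \<Rightarrow> 'e) \<Rightarrow> ('x \<Rightarrow> 'e)"
    and \<omega> :: "'x set"
  assumes "locally_compact_space (euclidean :: 'x topology)"
    and "doubling_metric_measure M"
    and "euclidean_vector_bundle TYPE('f::euclidean_space) B"
    and "self_adjoint B M D A"
    and "nonnegative_operator B M D A"
    and "borel_functional_calculus B M D A \<Phi>"
    and "ultracontractive B M \<Phi>"
    and "davies_gaffney B M \<Phi>"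
    and "local_weyl_law B M \<Phi>"
    and "\<omega> \<in> sets M"
    and "0 < emeasure M \<omega>"
  shows "(\<forall>T0 C K :: real. 0 < T0 \<and> 0 < C \<and> 0 < K \<and>
            (\<forall>T \<in> {0<..T0}. observability B M \<Phi> \<omega> T (C * exp (K / T))) \<longrightarrow>
            (max_ess_dist M \<omega>)\<^sup>2 / 2 \<le> ennreal K) \<and>
         (max_ess_dist M \<omega>)\<^sup>2 / 4 \<le> heat_control_rate B M \<Phi> \<omega>"
proof -
  interpret davies_gaffney_calculus B "TYPE('f)" M D A \<Phi>
    using assms by unfold_locales
  note \<omega> = assms(10,11)
  have divide: "x / ennreal c \<le> ennreal K" if "x \<le> ennreal (c * K)" "0 < c" "0 < K" for x c K
    using divide_right_mono_ennreal[OF that(1), of "ennreal c"] that(2,3)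
    by (simp add: divide_ennreal)
  show ?thesis
  proof (intro conjI allI impI)
    fix T0 C K :: real
    assume *: "0 < T0 \<and> 0 < C \<and> 0 < K \<and>
      (\<forall>T \<in> {0<..T0}. observability B M \<Phi> \<omega> T (C * exp (K / T)))"
    then have obs: "0 < T0" "0 < C"
      "\<And>T. \<lbrakk>0 < T; T \<le> T0\<rbrakk> \<Longrightarrow> observability B M \<Phi> \<omega> T (C * exp (K / T))"
      by auto
    have "(max_ess_dist M \<omega>)\<^sup>2 \<le> ennreal (2 * K)"
      using * by (intro max_ess_dist_power2_le[OF \<omega>] observability_decay_bound[OF _ _ _ obs]) auto
    then show "(max_ess_dist M \<omega>)\<^sup>2 / 2 \<le> ennreal K"
      using divide[of _ 2 K] * by simp
  next
    show "(max_ess_dist M \<omega>)\<^sup>2 / 4 \<le> heat_control_rate B M \<Phi> \<omega>"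
      unfolding heat_control_rate_def
    \<comment> \<open>Each admissible rate is bounded separately; if there is none, the infimum is
      infinite and the claim is trivial.\<close>
    proof (rule INF_greatest)
      fix K assume "K \<in> {K. 0 < K \<and> (\<exists>C>0. \<exists>T0>0. \<forall>T \<in> {0<..T0}.
        control_cost B M \<Phi> \<omega> T \<le> ennreal (C * exp (K / T)))}"
      then obtain C T0 where *: "0 < K" "0 < C" "0 < T0"
        "\<And>T. \<lbrakk>0 < T; T \<le> T0\<rbrakk> \<Longrightarrow> control_cost B M \<Phi> \<omega> T \<le> ennreal (C * exp (K / T))"
        by auto
      have "(max_ess_dist M \<omega>)\<^sup>2 \<le> ennreal (4 * K)"
        using \<open>0 < K\<close>
        by (intro max_ess_dist_power2_le[OF \<omega>] control_cost_decay_bound[OF _ _ _ \<omega>(1) *(3,2,4)]) auto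
      then show "(max_ess_dist M \<omega>)\<^sup>2 / 4 \<le> ennreal K"
        using divide[of _ 4 K] * by simp
    qed
  qed
qed

end
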